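(* Let $(\boldsymbol{X}(\cdot,t),\mu(\cdot,t))\in[H^1(\mathbb{T})]^2\times H^1(\mathbb{T})$ be the solution of the variational problem $$\bigl(\boldsymbol{n}\cdot\partial_t\boldsymbol{X},\varphi\bigr)_{\Gamma(t)}+\bigl(\partial_s\mu,\partial_s\varphi\bigr)_{\Gamma(t)}=0,\qquad\forall\varphi\in H^1(\mathbb{T}),$$ $$\bigl(\mu,\boldsymbol{n}\cdot\boldsymbol{\omega}\bigr)_{\Gamma(t)}-\bigl(\boldsymbol{Z}_k(\boldsymbol{n})\partial_s\boldsymbol{X},\partial_s\boldsymbol{\omega}\bigr)_{\Gamma(t)}=0,\qquad\forall\boldsymbol{\omega}\in[H^1(\mathbb{T})]^2,$$ with initial curve $\Gamma(0)=\Gamma_0$ given by the arclength parametrization $\boldsymbol{X}_0(s)=(x_0(s),y_0(s))^T$, $0\le s\le L_0$. Then the area $A(t)$ is conserved and the energy $W_c(t)$ is dissipative, i.e. $$A(t)\equiv\int_0^{L_0}y_0(s)x_0'(s)\,ds,\qquad W_c(t)\le W_c(t_1)\le\int_0^{L_0}\gamma(\boldsymbol{n})\,ds,\qquad t\ge t_1\ge0,$$ where in the last integral $\boldsymbol{n}$ is the outward unit normal of the initial curve $\Gamma_0$.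
   Context: $\mathbb{S}^1\subset\mathbb{R}^2$ is the unit circle, $\mathbb{R}^+=(0,\infty)$, and $^\perp$ denotes clockwise rotation by $\pi/2$, i.e. $(a,b)^\perp=(b,-a)$. The anisotropic surface energy $\gamma:\mathbb{S}^1\to\mathbb{R}^+$ is extended to $\mathbb{R}^2$ by $\gamma(\boldsymbol{p})=|\boldsymbol{p}|\gamma(\boldsymbol{p}/|\boldsymbol{p}|)$ for $\boldsymbol{p}\ne\boldsymbol{0}$, $\gamma(\boldsymbol{0})=0$, and $\boldsymbol{\xi}(\boldsymbol{n})=\nabla\gamma(\boldsymbol{p})|_{\boldsymbol{p}=\boldsymbol{n}}$ for $\boldsymbol{n}\in\mathbb{S}^1$. For a stabilizing function $k:\mathbb{S}^1\to\mathbb{R}^+$, $\boldsymbol{Z}_k(\boldsymbol{n})=\gamma(\boldsymbol{n})I_2-\boldsymbol{n}\boldsymbol{\xi}(\boldsymbol{n})^T-\boldsymbol{\xi}(\boldsymbol{n})\boldsymbol{n}^T+k(\boldsymbol{n})\boldsymbol{n}\boldsymbol{n}^T$, where $I_2$ is the $2\times2$ identity matrix. $\mathbb{T}=\mathbb{R}/\mathbb{Z}=[0,1]$ is the periodic unit interval, and $H^1(\mathbb{T})$ is the space of $u\in L^2(\mathbb{T})$ with $\partial_\rho u\in L^2(\mathbb{T})$. The closed curve is $\Gamma(t)=\boldsymbol{X}(\mathbb{T},t)$, $\boldsymbol{X}(\rho,t)=(x(\rho,t),y(\rho,t))^T$, with arclength $s(\rho,t)=\int_0^\rho|\partial_q\boldsymbol{X}(q,t)|\,dq$,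 so $\partial_\rho s=|\partial_\rho\boldsymbol{X}|$ (assumed bounded for all $t$) and $\partial_s=|\partial_\rho\boldsymbol{X}|^{-1}\partial_\rho$; the parametrizations by $\rho$ and by $s$ are not distinguished in notation. The initial condition is $\boldsymbol{X}(\rho,0)=\boldsymbol{X}_0(L_0\rho)\in[H^1(\mathbb{T})]^2$, where $L_0$ is the length of $\Gamma_0$. The unit tangent is $\boldsymbol{\tau}=\partial_s\boldsymbol{X}$ and the outward unit normal is $\boldsymbol{n}=-\boldsymbol{\tau}^\perp$. The inner product is $(u,v)_{\Gamma(t)}=\int_{\mathbb{T}}u\cdot v\,\partial_\rho s\,d\rho$ for scalar- or vector-valued $u,v$. With $L(t)$ the length of $\Gamma(t)$, the area of the region enclosed by $\Gamma(t)$ and the free energy of $\Gamma(t)$ are $A(t)=\int_0^{L(t)}y(s,t)\,\partial_sx(s,t)\,ds$ and $W_c(t)=\int_{\Gamma(t)}\gamma(\boldsymbol{n})\,ds$, $t\ge0$. *)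

theory Defs
  imports "HOL-Analysis.Analysis"
begin

section \<open>Sobolev functions on the circle \<open>\<real>/L\<int>\<close>\<close>

text \<open>
  Functions on \<open>\<real>/L\<int>\<close> are functions on the reals of which only the values on \<open>{0..L}\<close>, up to
  null sets, matter. Periodicity of the elements of \<open>H\<^sup>1\<close> is enforced by the periodic test
  functions in the definition of the weak derivative.
\<close>

definition torus :: "real \<Rightarrow> real measure" where
  "torus L = lebesgue_on {0..L}"

definition L2 :: "real \<Rightarrow> (real \<Rightarrow> 'a::euclidean_space) set" where
  "L2 L = {u. u \<in> borel_measurable (torus L) \<and> integrable (torus L) (\<lambda>x. (norm (u x))\<^sup>2)}"

definition test_fun :: "real \<Rightarrow> (real \<Rightarrow> real) \<Rightarrow> bool" where
  "test_fun L \<psi> \<longleftrightarrow> \<psi> C1_differentiable_on UNIV \<and> (\<forall>x. \<psi> (x + L) = \<psi> x)"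

definition is_weak_deriv ::
    "real \<Rightarrow> (real \<Rightarrow> 'a::euclidean_space) \<Rightarrow> (real \<Rightarrow> 'a) \<Rightarrow> bool" where
  "is_weak_deriv L u v \<longleftrightarrow>
     (\<forall>\<psi>. test_fun L \<psi> \<longrightarrow>
        (LINT x|torus L. deriv \<psi> x *\<^sub>R u x) = - (LINT x|torus L. \<psi> x *\<^sub>R v x))"

definition H1 :: "real \<Rightarrow> (real \<Rightarrow> 'a::euclidean_space) set" where
  "H1 L = {u \<in> L2 L. \<exists>v \<in> L2 L. is_weak_deriv L u v}"

text \<open>A representative of the weak derivative, which is unique up to null sets.\<close>

definition wderiv :: "real \<Rightarrow> (real \<Rightarrow> 'a::euclidean_space) \<Rightarrow> real \<Rightarrow> 'a" where
  "wderiv L u = (SOME v. v \<in> L2 L \<and> is_weak_deriv L u v)"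

definition H1_norm :: "real \<Rightarrow> (real \<Rightarrow> 'a::euclidean_space) \<Rightarrow> real" where
  "H1_norm L u =
     sqrt ((LINT x|torus L. (norm (u x))\<^sup>2) + (LINT x|torus L. (norm (wderiv L u x))\<^sup>2))"

text \<open>
  For a time-dependent function, \<open>X t\<close> stands for \<open>X(\<cdot>,t)\<close>. The time derivative is that of
  \<open>t \<mapsto> X(\<cdot>,t)\<close> as a map into \<open>H\<^sup>1(\<real>/\<int>)\<close>.
\<close>

definition has_time_deriv ::
    "(real \<Rightarrow> real \<Rightarrow> 'a::euclidean_space) \<Rightarrow> real \<Rightarrow> (real \<Rightarrow> 'a) \<Rightarrow> bool" where
  "has_time_deriv X t V \<longleftrightarrow> V \<in> H1 1 \<and>
     ((\<lambda>h. H1_norm 1 (\<lambda>\<rho>. (X (t + h) \<rho> - X t \<rho>) /\<^sub>R h - V \<rho>)) \<longlongrightarrow> 0) (at 0)"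

definition time_deriv ::
    "(real \<Rightarrow> real \<Rightarrow> 'a::euclidean_space) \<Rightarrow> real \<Rightarrow> real \<Rightarrow> 'a" where
  "time_deriv X t = (SOME V. has_time_deriv X t V)"


section \<open>Anisotropic surface energy\<close>

text \<open>Clockwise rotation by \<open>\<pi>/2\<close>.\<close>

definition perp :: "real^2 \<Rightarrow> real^2" where
  "perp v = vector [v $ 2, - v $ 1]"

definition hom_ext :: "(real^2 \<Rightarrow> real) \<Rightarrow> real^2 \<Rightarrow> real" where
  "hom_ext \<gamma> p = (if p = 0 then 0 else norm p * \<gamma> (p /\<^sub>R norm p))"

definition xi :: "(real^2 \<Rightarrow> real) \<Rightarrow> real^2 \<Rightarrow> real^2" where
  "xi \<gamma> n = (THE D. GDERIV (hom_ext \<gamma>) n :> D)"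

text \<open>
  Only the values of \<open>\<gamma>\<close> on the unit circle are used. By homogeneity, the two regularity
  conditions say that the extended energy is \<open>C\<^sup>1\<close> away from the origin.
\<close>

definition surface_energy :: "(real^2 \<Rightarrow> real) \<Rightarrow> bool" where
  "surface_energy \<gamma> \<longleftrightarrow>
     (\<forall>n\<in>sphere 0 1. 0 < \<gamma> n) \<and>
     (\<forall>n\<in>sphere 0 1. hom_ext \<gamma> differentiable (at n)) \<and>
     continuous_on (sphere 0 1) (xi \<gamma>)"

definition outer_prod :: "real^2 \<Rightarrow> real^2 \<Rightarrow> real^2^2" where
  "outer_prod u v = (columnvector u :: real^1^2) ** (rowvector v :: real^2^1)"

definition Z_mat :: "(real^2 \<Rightarrow> real) \<Rightarrow> (real^2 \<Rightarrow> real) \<Rightarrow> real^2 \<Rightarrow> real^2^2" where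
  "Z_mat \<gamma> k n = \<gamma> n *\<^sub>R mat 1 - outer_prod n (xi \<gamma> n) - outer_prod (xi \<gamma> n) n
                  + k n *\<^sub>R outer_prod n n"


section \<open>Closed curves parametrized over \<open>\<real>/\<int>\<close>\<close>

text \<open>
  The arclength \<open>s\<close> satisfies \<open>\<partial>\<^sub>\<rho>s = \<bar>\<partial>\<^sub>\<rho>X\<bar>\<close>. It has to be nonzero almost everywhere for
  \<open>\<partial>\<^sub>s\<close>, \<open>\<tau>\<close> and \<open>n\<close> to be defined. No positive lower bound is required.
\<close>

definition ds_drho :: "(real \<Rightarrow> real^2) \<Rightarrow> real \<Rightarrow> real" where
  "ds_drho X \<rho> = norm (wderiv 1 X \<rho>)"

definition closed_curve :: "(real \<Rightarrow> real^2) \<Rightarrow> bool" where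
  "closed_curve X \<longleftrightarrow> X \<in> H1 1 \<and>
     (AE \<rho> in torus 1. 0 < ds_drho X \<rho>) \<and>
     (\<exists>C. AE \<rho> in torus 1. ds_drho X \<rho> \<le> C)"

definition arc_deriv ::
    "(real \<Rightarrow> real^2) \<Rightarrow> (real \<Rightarrow> 'a::euclidean_space) \<Rightarrow> real \<Rightarrow> 'a" where
  "arc_deriv X u \<rho> = wderiv 1 u \<rho> /\<^sub>R ds_drho X \<rho>"

definition tangent :: "(real \<Rightarrow> real^2) \<Rightarrow> real \<Rightarrow> real^2" where
  "tangent X = arc_deriv X X"

text \<open>This is the outward normal for clockwise orientation.\<close>

definition normal :: "(real \<Rightarrow> real^2) \<Rightarrow> real \<Rightarrow> real^2" where
  "normal X \<rho> = - perp (tangent X \<rho>)"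

text \<open>The integral with respect to arclength, \<open>ds = \<partial>\<^sub>\<rho>s d\<rho>\<close>, of a function of \<open>\<rho>\<close>.\<close>

definition curve_integral :: "(real \<Rightarrow> real^2) \<Rightarrow> (real \<Rightarrow> real) \<Rightarrow> real" where
  "curve_integral X f = (LINT \<rho>|torus 1. f \<rho> * ds_drho X \<rho>)"

definition curve_integrable :: "(real \<Rightarrow> real^2) \<Rightarrow> (real \<Rightarrow> real) \<Rightarrow> bool" where
  "curve_integrable X f \<longleftrightarrow> integrable (torus 1) (\<lambda>\<rho>. f \<rho> * ds_drho X \<rho>)"

definition curve_inner ::
    "(real \<Rightarrow> real^2) \<Rightarrow> (real \<Rightarrow> 'a::euclidean_space) \<Rightarrow> (real \<Rightarrow> 'a) \<Rightarrow> real" where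
  "curve_inner X u v = curve_integral X (\<lambda>\<rho>. u \<rho> \<bullet> v \<rho>)"

definition area :: "(real \<Rightarrow> real^2) \<Rightarrow> real" where
  "area X = curve_integral X (\<lambda>\<rho>. X \<rho> $ 2 * arc_deriv X (\<lambda>q. X q $ 1) \<rho>)"

definition energy :: "(real^2 \<Rightarrow> real) \<Rightarrow> (real \<Rightarrow> real^2) \<Rightarrow> real" where
  "energy \<gamma> X = curve_integral X (\<lambda>\<rho>. \<gamma> (normal X \<rho>))"

definition arclength_param :: "real \<Rightarrow> (real \<Rightarrow> real^2) \<Rightarrow> bool" where
  "arclength_param L X \<longleftrightarrow> 0 < L \<and> X \<in> H1 L \<and> (AE s in torus L. norm (wderiv L X s) = 1)"


section \<open>The variational problem\<close>

text \<open>
  Without a lower bound on \<open>\<partial>\<^sub>\<rho>s\<close>, the product \<open>\<partial>\<^sub>s\<mu> \<partial>\<^sub>s\<phi>\<close> need not be integrable along the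
  curve, so that existence of this integral is part of the first equation. All other integrands
  in the two equations are integrable for functions in \<open>H\<^sup>1\<close>.
\<close>

definition variational_solution ::
    "(real^2 \<Rightarrow> real) \<Rightarrow> (real^2 \<Rightarrow> real) \<Rightarrow>
     (real \<Rightarrow> real \<Rightarrow> real^2) \<Rightarrow> (real \<Rightarrow> real \<Rightarrow> real) \<Rightarrow> bool" where
  "variational_solution \<gamma> k X \<mu> \<longleftrightarrow>
     (\<forall>t\<ge>0. closed_curve (X t)) \<and>
     (\<forall>t\<ge>0. ((\<lambda>r. H1_norm 1 (\<lambda>\<rho>. X r \<rho> - X t \<rho>)) \<longlongrightarrow> 0) (at t within {0..})) \<and>
     (\<forall>t>0. \<exists>V. has_time_deriv X t V) \<and>
     (\<forall>t>0. \<mu> t \<in> H1 1) \<and>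
     (\<forall>t>0. \<forall>\<phi>\<in>H1 1.
        curve_integrable (X t) (\<lambda>\<rho>. arc_deriv (X t) (\<mu> t) \<rho> * arc_deriv (X t) \<phi> \<rho>) \<and>
        curve_inner (X t) (\<lambda>\<rho>. normal (X t) \<rho> \<bullet> time_deriv X t \<rho>) \<phi>
        + curve_inner (X t) (arc_deriv (X t) (\<mu> t)) (arc_deriv (X t) \<phi>) = 0) \<and>
     (\<forall>t>0. \<forall>\<omega>\<in>H1 1.
        curve_inner (X t) (\<mu> t) (\<lambda>\<rho>. normal (X t) \<rho> \<bullet> \<omega> \<rho>)
        - curve_inner (X t)
            (\<lambda>\<rho>. Z_mat \<gamma> k (normal (X t) \<rho>) *v arc_deriv (X t) (X t) \<rho>)
            (arc_deriv (X t) \<omega>) = 0)"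

end

(*
  Written as W = \<integral> F(\<partial>\<^sub>\<rho>X) d\<rho> with F(p) = \<gamma>(-p\<^sup>\<bottom>), the energy depends on the curve through a
  Lipschitz, 1-homogeneous density that is differentiable away from the origin. As \<partial>\<^sub>\<rho>X vanishes
  only on a null set, W is differentiable along the evolution, and Euler's relation \<xi>(n) \<bullet> n = \<gamma>(n)
  identifies W' with (Z\<^sub>k(n) \<partial>\<^sub>sX, \<partial>\<^sub>s\<omega>) for \<omega> = \<partial>\<^sub>tX. The second equation with this \<omega> and the
  first with \<phi> = \<mu> give W' = - (\<partial>\<^sub>s\<mu>, \<partial>\<^sub>s\<mu>) \<le> 0. For the area, integration by parts gives
  A' = (n \<bullet> \<partial>\<^sub>tX, 1), which is 0 by the first equation with \<phi> = 1. Both functionals are continuous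
  up to t = 0, where they are evaluated by rescaling the arclength parametrization.
*)
theory Submission
  imports Defs
begin

section \<open>Square-integrable functions on the circle\<close>

text \<open>Weak derivatives are defined by testing against periodic C1 functions only, whereas the
  area identity integrates by parts between two H1 functions. Test functions must therefore be dense
  in H1: a mean-zero L2 approximation of the derivative is integrated, and a Poincare inequality,
  itself obtained by duality, controls the function. \<open>wderiv\<close> is an arbitrary choice,
  so its linearity, its components and its behaviour under rescaling are almost-everywhere facts
  that rest on uniqueness of the weak derivative. For the energy, the obstacle is that the speed of
  the parametrization has no positive lower bound, while the gradient of the density is homogeneous
  of degree 0 and has no limit at the origin. The argument uses only a global Lipschitz bound and
  differentiability at almost every value of the curve's derivative. At time 0 only continuity in H1
  is given, so time derivatives are taken on open intervals.\<close>

lemma space_torus [simp]: "space (torus L) = {0..L}"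
  by (simp add: torus_def)

lemma finite_measure_torus: "finite_measure (torus L)"
  unfolding torus_def by (rule finite_measure_lebesgue_on) simp

lemma measure_torus: "0 \<le> L \<Longrightarrow> measure (torus L) (space (torus L)) = L"
  by (simp add: torus_def measure_restrict_space)

lemma integrable_const_torus [simp]: "integrable (torus L) (\<lambda>x. c::'a::euclidean_space)"
  using finite_measure.integrable_const[OF finite_measure_torus] .

lemma L2_D:
  assumes "u \<in> L2 L"
  shows "u \<in> borel_measurable (torus L)" "integrable (torus L) (\<lambda>x. (norm (u x))\<^sup>2)"
  using assms by (auto simp: L2_def)

lemma L2_integrable_inner:
  assumes "u \<in> L2 L" "v \<in> L2 L"
  shows "integrable (torus L) (\<lambda>x. u x \<bullet> v x)"
proof (rule Bochner_Integration.integrable_bound)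
  note [measurable] = L2_D(1)[OF assms(1)] L2_D(1)[OF assms(2)]
  show "integrable (torus L) (\<lambda>x. (norm (u x))\<^sup>2 + (norm (v x))\<^sup>2)"
    using assms by (intro Bochner_Integration.integrable_add L2_D)
  show "(\<lambda>x. u x \<bullet> v x) \<in> borel_measurable (torus L)" by measurable
  have "\<bar>u x \<bullet> v x\<bar> \<le> (norm (u x))\<^sup>2 + (norm (v x))\<^sup>2" for x
  proof -
    have "\<bar>u x \<bullet> v x\<bar> \<le> norm (u x) * norm (v x)" by (rule Cauchy_Schwarz_ineq2)
    also have "\<dots> \<le> (norm (u x))\<^sup>2 + (norm (v x))\<^sup>2"
      using sum_squares_bound[of "norm (u x)" "norm (v x)"]
        mult_nonneg_nonneg[OF norm_ge_zero[of "u x"] norm_ge_zero[of "v x"]] by linarith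
    finally show ?thesis .
  qed
  then show "AE x in torus L. norm (u x \<bullet> v x) \<le> norm ((norm (u x))\<^sup>2 + (norm (v x))\<^sup>2)"
    by simp
qed

lemma L2_scaleR: "u \<in> L2 L \<Longrightarrow> (\<lambda>x. c *\<^sub>R u x) \<in> L2 L"
  by (auto simp: L2_def power_mult_distrib)

lemma L2_add:
  assumes "u \<in> L2 L" "v \<in> L2 L"
  shows "(\<lambda>x. u x + v x) \<in> L2 L"
proof -
  have "integrable (torus L) (\<lambda>x. (norm (u x))\<^sup>2 + 2 * (u x \<bullet> v x) + (norm (v x))\<^sup>2)"
    using assms by (intro Bochner_Integration.integrable_add integrable_mult_right
        L2_D L2_integrable_inner)
  also have "(\<lambda>x. (norm (u x))\<^sup>2 + 2 * (u x \<bullet> v x) + (norm (v x))\<^sup>2) = (\<lambda>x. (norm (u x + v x))\<^sup>2)"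
    by (simp add: power2_norm_eq_inner inner_add_left inner_add_right inner_commute algebra_simps)
  finally show ?thesis using assms by (auto simp: L2_def)
qed

lemma L2_diff:
  assumes "u \<in> L2 L" "v \<in> L2 L"
  shows "(\<lambda>x. u x - v x) \<in> L2 L"
  using L2_add[OF assms(1) L2_scaleR[OF assms(2), of "-1"]] by simp

lemma L2_const: "(\<lambda>x. c) \<in> L2 L"
  by (auto simp: L2_def)

lemma L2_inner_const: "u \<in> L2 L \<Longrightarrow> (\<lambda>x. u x \<bullet> b) \<in> L2 L"
proof -
  assume u: "u \<in> L2 L"
  note [measurable] = L2_D(1)[OF u]
  have "integrable (torus L) (\<lambda>x. (u x \<bullet> b)\<^sup>2)"
  proof (rule Bochner_Integration.integrable_bound)
    show "integrable (torus L) (\<lambda>x. (norm (u x))\<^sup>2 * (norm b)\<^sup>2)"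
      using u by (intro integrable_mult_left L2_D)
    show "AE x in torus L. norm ((u x \<bullet> b)\<^sup>2) \<le> norm ((norm (u x))\<^sup>2 * (norm b)\<^sup>2)"
      using Cauchy_Schwarz_ineq2[of "u _" b]
      by (auto simp: power_mult_distrib[symmetric] abs_le_square_iff[symmetric])
  qed measurable
  then show ?thesis unfolding L2_def by (auto intro!: borel_measurable_inner L2_D(1)[OF u])
qed

lemma L2_norm_fun: "u \<in> L2 L \<Longrightarrow> (\<lambda>x. norm (u x)) \<in> L2 L"
  by (auto simp: L2_def)

lemma L2_integrable: "u \<in> L2 L \<Longrightarrow> integrable (torus L) u"
  using L2_integrable_inner[OF L2_norm_fun L2_const[of "1::real"], of u L]
  by (auto simp: L2_def intro: integrable_norm_cancel)

lemma L2_bounded: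
  assumes "u \<in> borel_measurable (torus L)" "\<And>x. x \<in> {0..L} \<Longrightarrow> norm (u x) \<le> B"
  shows "u \<in> L2 L"
proof -
  note [measurable] = assms(1)
  have "integrable (torus L) (\<lambda>x. (norm (u x))\<^sup>2)"
  proof (rule Bochner_Integration.integrable_bound)
    show "integrable (torus L) (\<lambda>x. B\<^sup>2)" by simp
    show "AE x in torus L. norm ((norm (u x))\<^sup>2) \<le> norm (B\<^sup>2)"
      by (rule AE_I2) (auto intro!: power_mono assms(2))
  qed measurable
  then show ?thesis using assms(1) by (auto simp: L2_def)
qed

lemma L2_continuous:
  assumes "continuous_on UNIV (u :: real \<Rightarrow> 'a::euclidean_space)"
  shows "u \<in> L2 L"
proof -
  have c: "continuous_on {0..L} u" using assms continuous_on_subset by blast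
  then have "bounded (u ` {0..L})"
    by (intro compact_imp_bounded compact_continuous_image compact_Icc)
  then obtain B where "\<And>x. x \<in> {0..L} \<Longrightarrow> norm (u x) \<le> B"
    by (metis bounded_iff imageI)
  moreover have "u \<in> borel_measurable (torus L)"
    unfolding torus_def using c by (intro continuous_imp_measurable_on_sets_lebesgue) auto
  ultimately show ?thesis by (rule L2_bounded[rotated])
qed

section \<open>The L2 seminorm, the Cauchy-Schwarz inequality and convergence of pairings\<close>

definition L2_norm :: "real \<Rightarrow> (real \<Rightarrow> 'a::euclidean_space) \<Rightarrow> real" where
  "L2_norm L u = sqrt (LINT x|torus L. (norm (u x))\<^sup>2)"

lemma L2_norm_nonneg [simp]: "0 \<le> L2_norm L u"
  by (simp add: L2_norm_def)

lemma L2_norm_square: "(L2_norm L u)\<^sup>2 = (LINT x|torus L. (norm (u x))\<^sup>2)"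
  by (simp add: L2_norm_def)

lemma L2_norm_cong_AE:
  assumes "u \<in> borel_measurable (torus L)" "v \<in> borel_measurable (torus L)"
    and "AE x in torus L. u x = v x"
  shows "L2_norm L u = L2_norm L v"
  unfolding L2_norm_def using assms by (intro arg_cong[where f = sqrt] integral_cong_AE) auto

lemma L2_norm_norm [simp]: "L2_norm L (\<lambda>x. norm (u x)) = L2_norm L u"
  by (simp add: L2_norm_def)

lemma L2_norm_scaleR: "L2_norm L (\<lambda>x. c *\<^sub>R u x) = \<bar>c\<bar> * L2_norm L u"
  by (simp add: L2_norm_def power_mult_distrib real_sqrt_mult)

lemma L2_norm_diff_commute: "L2_norm L (\<lambda>x. u x - v x) = L2_norm L (\<lambda>x. v x - u x)"
  by (simp add: L2_norm_def norm_minus_commute)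

lemma L2_norm_square_add:
  assumes "u \<in> L2 L" "v \<in> L2 L"
  shows "(L2_norm L (\<lambda>x. u x + v x))\<^sup>2
    = (L2_norm L u)\<^sup>2 + 2 * (LINT x|torus L. u x \<bullet> v x) + (L2_norm L v)\<^sup>2"
proof -
  have "(LINT x|torus L. (norm (u x + v x))\<^sup>2)
      = (LINT x|torus L. (norm (u x))\<^sup>2 + 2 * (u x \<bullet> v x) + (norm (v x))\<^sup>2)"
    by (simp add: power2_norm_eq_inner inner_add_left inner_add_right inner_commute algebra_simps)
  then show ?thesis
    using assms by (simp add: L2_norm_square L2_D L2_integrable_inner)
qed

text \<open>The quadratic polynomial \<open>a\<close> maps to the squared seminorm of
  \<open>u + a v\<close> and is nonnegative. It degenerates to an affine function if
  \<open>v\<close> has seminorm 0, hence the case distinction.\<close>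

lemma L2_Cauchy_Schwarz:
  assumes "u \<in> L2 L" "v \<in> L2 L"
  shows "\<bar>LINT x|torus L. u x \<bullet> v x\<bar> \<le> L2_norm L u * L2_norm L v"
proof -
  define B where "B = (LINT x|torus L. u x \<bullet> v x)"
  have q: "0 \<le> (L2_norm L u)\<^sup>2 + 2 * a * B + a\<^sup>2 * (L2_norm L v)\<^sup>2" for a
  proof -
    have "0 \<le> (L2_norm L (\<lambda>x. u x + a *\<^sub>R v x))\<^sup>2" by simp
    also have "\<dots> = (L2_norm L u)\<^sup>2 + 2 * (LINT x|torus L. u x \<bullet> (a *\<^sub>R v x))
        + (L2_norm L (\<lambda>x. a *\<^sub>R v x))\<^sup>2"
      using assms by (intro L2_norm_square_add L2_scaleR)
    finally show ?thesis by (simp add: L2_norm_scaleR power_mult_distrib B_def)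
  qed
  have "B\<^sup>2 \<le> (L2_norm L u * L2_norm L v)\<^sup>2"
  proof (cases "L2_norm L v = 0")
    case True
    have "B = 0"
    proof (rule ccontr)
      assume "B \<noteq> 0"
      then show False
        \<comment> \<open>With this \<open>a\<close> the affine function takes the value -1.\<close>
        using q[of "- ((L2_norm L u)\<^sup>2 + 1) / (2 * B)"] True by (simp add: field_simps)
    qed
    then show ?thesis by simp
  next
    case False
    then have "0 < L2_norm L v * L2_norm L v"
      using L2_norm_nonneg[of L v] by (simp add: zero_less_mult_iff less_le)
    \<comment> \<open>The minimizer of the quadratic is
      \<open>- B / (L2_norm L v)\<^sup>2\<close>.\<close>
    moreover have "0 \<le> ((L2_norm L u)\<^sup>2 * (L2_norm L v)\<^sup>2 - B\<^sup>2) / (L2_norm L v * L2_norm L v)"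
      using q[of "- B / (L2_norm L v)\<^sup>2"] False by (simp add: field_simps power2_eq_square)
    ultimately show ?thesis
      by (simp add: zero_le_divide_iff power_mult_distrib)
  qed
  then show ?thesis unfolding B_def
    by (metis L2_norm_nonneg abs_le_square_iff abs_of_nonneg mult_nonneg_nonneg)
qed

lemma L2_norm_triangle:
  assumes "u \<in> L2 L" "v \<in> L2 L"
  shows "L2_norm L (\<lambda>x. u x + v x) \<le> L2_norm L u + L2_norm L v"
proof -
  have "(L2_norm L (\<lambda>x. u x + v x))\<^sup>2 \<le> (L2_norm L u + L2_norm L v)\<^sup>2"
    using L2_norm_square_add[OF assms] L2_Cauchy_Schwarz[OF assms]
    by (simp add: power2_sum)
  then show ?thesis by (rule power2_le_imp_le) simp
qed

lemma L2_norm_triangle_diff: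
  assumes "u \<in> L2 L" "v \<in> L2 L" "w \<in> L2 L"
  shows "L2_norm L (\<lambda>x. u x - w x) \<le> L2_norm L (\<lambda>x. u x - v x) + L2_norm L (\<lambda>x. v x - w x)"
  using L2_norm_triangle[OF L2_diff[OF assms(1,2)] L2_diff[OF assms(2,3)]] by simp

lemma L2_norm_const: "0 \<le> L \<Longrightarrow> L2_norm L (\<lambda>x. c) = sqrt L * norm c"
  using measure_torus[of L] by (simp add: L2_norm_def real_sqrt_mult)

lemma L1_le_L2_norm:
  assumes "u \<in> L2 1"
  shows "(LINT x|torus 1. norm (u x)) \<le> L2_norm 1 u"
  using L2_Cauchy_Schwarz[OF L2_norm_fun[OF assms] L2_const[of "1::real"]]
  by (simp add: L2_norm_const)

lemma integral_le_L2_norm: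
  assumes "u \<in> L2 1"
  shows "norm (LINT x|torus 1. u x) \<le> L2_norm 1 u"
  using L1_le_L2_norm[OF assms] integral_norm_bound order_trans by blast

lemma L2_norm_eq_0_imp_AE:
  assumes "u \<in> L2 L" "L2_norm L u = 0"
  shows "AE x in torus L. u x = 0"
proof -
  have "(LINT x|torus L. (norm (u x))\<^sup>2) = 0"
    using assms(2) by (simp add: L2_norm_def)
  then have "AE x in torus L. (norm (u x))\<^sup>2 = 0"
    using integral_nonneg_eq_0_iff_AE[OF L2_D(2)[OF assms(1)]] by simp
  then show ?thesis by simp
qed

lemma L2_norm_le_of_close:
  assumes "u \<in> L2 L" "v \<in> L2 L"
  shows "L2_norm L u \<le> L2_norm L v + L2_norm L (\<lambda>x. u x - v x)"
  using L2_norm_triangle[OF assms(2) L2_diff[OF assms]] by simp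

text \<open>The difference of the pairings splits into (u - u', v) + (u', v - v'), and the norm of v
  stays bounded near the limit. This gives both the continuity of the area and the limit of its
  difference quotient.\<close>

lemma tendsto_L2_inner:
  assumes "\<forall>\<^sub>F i in F. u i \<in> L2 L" "\<forall>\<^sub>F i in F. v i \<in> L2 L" "u' \<in> L2 L" "v' \<in> L2 L"
    and "((\<lambda>i. L2_norm L (\<lambda>x. u i x - u' x)) \<longlongrightarrow> 0) F"
    and "((\<lambda>i. L2_norm L (\<lambda>x. v i x - v' x)) \<longlongrightarrow> 0) F"
  shows "((\<lambda>i. LINT x|torus L. u i x \<bullet> v i x) \<longlongrightarrow> (LINT x|torus L. u' x \<bullet> v' x)) F"
proof -
  let ?a = "\<lambda>i. L2_norm L (\<lambda>x. u i x - u' x)" and ?b = "\<lambda>i. L2_norm L (\<lambda>x. v i x - v' x)"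
  have "\<forall>\<^sub>F i in F. \<bar>(LINT x|torus L. u i x \<bullet> v i x) - (LINT x|torus L. u' x \<bullet> v' x)\<bar>
      \<le> ?a i * (L2_norm L v' + ?b i) + L2_norm L u' * ?b i"
    using assms(1,2)
  proof eventually_elim
    case (elim i)
    note du = L2_diff[OF elim(1) assms(3)] and dv = L2_diff[OF elim(2) assms(4)]
    have "(LINT x|torus L. u i x \<bullet> v i x) - (LINT x|torus L. u' x \<bullet> v' x)
        = (LINT x|torus L. (u i x - u' x) \<bullet> v i x + u' x \<bullet> (v i x - v' x))"
      using elim assms(3,4)
      by (simp add: L2_integrable_inner du dv inner_diff_left inner_diff_right)
    also have "\<dots> = (LINT x|torus L. (u i x - u' x) \<bullet> v i x)
          + (LINT x|torus L. u' x \<bullet> (v i x - v' x))"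
      using elim assms(3,4) du dv by (intro Bochner_Integration.integral_add L2_integrable_inner)
    finally have "\<bar>(LINT x|torus L. u i x \<bullet> v i x) - (LINT x|torus L. u' x \<bullet> v' x)\<bar>
        \<le> ?a i * L2_norm L (v i) + L2_norm L u' * ?b i"
      using L2_Cauchy_Schwarz[OF du elim(2)] L2_Cauchy_Schwarz[OF assms(3) dv] by linarith
    also have "\<dots> \<le> ?a i * (L2_norm L v' + ?b i) + L2_norm L u' * ?b i"
      using L2_norm_le_of_close[OF elim(2) assms(4)]
      by (intro add_right_mono mult_left_mono) auto
    finally show ?case .
  qed
  moreover have "((\<lambda>i. ?a i * (L2_norm L v' + ?b i) + L2_norm L u' * ?b i) \<longlongrightarrow>
      0 * (L2_norm L v' + 0) + L2_norm L u' * 0) F"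
    by (intro tendsto_intros assms)
  then have "((\<lambda>i. ?a i * (L2_norm L v' + ?b i) + L2_norm L u' * ?b i) \<longlongrightarrow> 0) F"
    by simp
  ultimately have "((\<lambda>i. (LINT x|torus L. u i x \<bullet> v i x) - (LINT x|torus L. u' x \<bullet> v' x)) \<longlongrightarrow> 0) F"
    unfolding real_norm_def[symmetric]
    by (rule Lim_null_comparison)
  then show ?thesis by (rule Lim_null[THEN iffD2])
qed

section \<open>Density of test functions\<close>

lemma AE_torus_not_in_negligible:
  assumes "negligible N"
  shows "AE x in torus L. x \<notin> N"
proof -
  have "AE x in lebesgue. x \<notin> N"
    using assms by (intro AE_not_in) (simp add: negligible_iff_null_sets)
  then show ?thesis
    unfolding torus_def by (subst AE_restrict_space_iff) auto
qed

text \<open>Dominated convergence for the squared distance. It closes each of the three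
  approximations below: by truncations, by continuous functions, by local means.\<close>

lemma L2_norm_tendsto_dominated:
  fixes u :: "nat \<Rightarrow> real \<Rightarrow> 'a::euclidean_space"
  assumes "\<And>n. u n \<in> borel_measurable (torus L)" "u' \<in> borel_measurable (torus L)"
    and "w \<in> L2 L" "\<And>n. AE x in torus L. norm (u n x - u' x) \<le> norm (w x)"
    and "AE x in torus L. (\<lambda>n. u n x) \<longlonglongrightarrow> u' x"
  shows "(\<lambda>n. L2_norm L (\<lambda>x. u n x - u' x)) \<longlonglongrightarrow> 0"
proof -
  note [measurable] = assms(1,2)
  have "(\<lambda>n. LINT x|torus L. (norm (u n x - u' x))\<^sup>2) \<longlonglongrightarrow> (LINT x|torus L. (0::real))"
  proof (rule integral_dominated_convergence)
    show "integrable (torus L) (\<lambda>x. (norm (w x))\<^sup>2)" by (rule L2_D(2)[OF assms(3)])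
    show "AE x in torus L. (\<lambda>n. (norm (u n x - u' x))\<^sup>2) \<longlonglongrightarrow> 0"
      using assms(5)
    proof eventually_elim
      case (elim x)
      have "(\<lambda>n. (norm (u n x - u' x))\<^sup>2) \<longlonglongrightarrow> (norm (u' x - u' x))\<^sup>2"
        by (intro tendsto_intros elim)
      then show ?case by simp
    qed
    show "AE x in torus L. norm ((norm (u n x - u' x))\<^sup>2) \<le> (norm (w x))\<^sup>2" for n
      using assms(4)[of n] by eventually_elim (simp add: power_mono)
  qed measurable
  then have "(\<lambda>n. sqrt (LINT x|torus L. (norm (u n x - u' x))\<^sup>2)) \<longlonglongrightarrow> sqrt 0"
    by (intro tendsto_real_sqrt) simp
  then show ?thesis by (simp add: L2_norm_def)
qed

text \<open>\<open>frac\<close> jumps at the integers: just to the right its values are near 0, just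
  to the left near 1. The condition \<open>g 0 = g 1\<close> absorbs the jump.\<close>

lemma continuous_on_periodic_extension:
  fixes g :: "real \<Rightarrow> 'a::metric_space"
  assumes g: "continuous_on {0..1} g" and "g 0 = g 1"
  shows "continuous_on UNIV (\<lambda>x. g (frac x))"
proof -
  have "isCont (\<lambda>x. g (frac x)) x" for x :: real
  proof (cases "x \<in> \<int>")
    case False
    then have "0 < frac x" "frac x < 1" by (auto simp: frac_gt_0_iff frac_lt_1)
    then have "isCont g (frac x)"
      using g by (intro continuous_on_interior) auto
    then show ?thesis
      using continuous_frac[OF False] isCont_o2 by blast
  next
    case True
    show ?thesis unfolding continuous_at_eps_delta
    proof (intro allI impI)
      fix e :: real assume "0 < e"
      obtain d0 where d0: "0 < d0" "\<And>y. y \<in> {0..1} \<Longrightarrow> dist y 0 < d0 \<Longrightarrow> dist (g y) (g 0) < e"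
        using g \<open>0 < e\<close> unfolding continuous_on_iff
        by (metis atLeastAtMost_iff order_refl zero_le_one)
      obtain d1 where d1: "0 < d1" "\<And>y. y \<in> {0..1} \<Longrightarrow> dist y 1 < d1 \<Longrightarrow> dist (g y) (g 1) < e"
        using g \<open>0 < e\<close> unfolding continuous_on_iff
        by (metis atLeastAtMost_iff order_refl zero_le_one)
      have "dist (g (frac y)) (g (frac x)) < e" if "dist y x < min 1 (min d0 d1)" for y
      proof (cases "x \<le> y")
        case True
        obtain k :: int where k: "x = of_int k" using \<open>x \<in> \<int>\<close> by (auto elim: Ints_cases)
        have "frac y = y - x"
          using that True by (auto simp: frac_unique_iff k dist_real_def minus_diff_eq)
        then show ?thesis using that True d0(2)[of "frac y"] \<open>x \<in> \<int>\<close>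
          by (simp add: dist_real_def k)
      next
        case False
        obtain k :: int where k: "x = of_int k" using \<open>x \<in> \<int>\<close> by (auto elim: Ints_cases)
        have "y - (y - x + 1) = of_int (k - 1)" by (simp add: k)
        then have "frac y = y - x + 1"
          using that False unfolding frac_unique_iff by (auto simp: dist_real_def)
        then show ?thesis using that False d1(2)[of "frac y"] \<open>x \<in> \<int>\<close> \<open>g 0 = g 1\<close>
          by (simp add: dist_real_def k)
      qed
      then show "\<exists>d>0. \<forall>y. dist y x < d \<longrightarrow> dist (g (frac y)) (g (frac x)) < e"
        using \<open>0 < d0\<close> \<open>0 < d1\<close> by (intro exI[of _ "min 1 (min d0 d1)"]) auto
    qed
  qed
  then show ?thesis by (simp add: continuous_at_imp_continuous_on)
qed

section \<open>Periodic test functions and antiderivatives\<close>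

lemma test_funI:
  assumes "\<And>x. (\<psi> has_real_derivative d x) (at x)" "continuous_on UNIV d"
    and "\<And>x. \<psi> (x + L) = \<psi> x"
  shows "test_fun L \<psi>" "deriv \<psi> = d"
proof -
  show "deriv \<psi> = d" using assms(1) by (intro ext DERIV_imp_deriv)
  show "test_fun L \<psi>" using assms
    by (auto simp: test_fun_def C1_differentiable_on_def has_real_derivative_iff_has_vector_derivative)
qed

lemma test_fun_D:
  assumes "test_fun L \<psi>"
  shows "(\<psi> has_real_derivative deriv \<psi> x) (at x)" "continuous_on UNIV (deriv \<psi>)"
    "continuous_on UNIV \<psi>" "\<psi> (x + L) = \<psi> x"
proof -
  obtain d where d: "\<And>x. (\<psi> has_real_derivative d x) (at x)" "continuous_on UNIV d"
    using assms
    by (auto simp: test_fun_def C1_differentiable_on_def has_real_derivative_iff_has_vector_derivative)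
  then have "deriv \<psi> = d" by (intro ext DERIV_imp_deriv)
  with d show "(\<psi> has_real_derivative deriv \<psi> x) (at x)" "continuous_on UNIV (deriv \<psi>)" by auto
  show "continuous_on UNIV \<psi>" using d(1) DERIV_isCont
    by (blast intro: continuous_at_imp_continuous_on)
  show "\<psi> (x + L) = \<psi> x" using assms by (simp add: test_fun_def)
qed

lemma test_fun_L2:
  assumes "test_fun L \<psi>"
  shows "\<psi> \<in> L2 M" "deriv \<psi> \<in> L2 M"
  using test_fun_D(2,3)[OF assms] by (auto intro: L2_continuous)

lemma test_fun_const: "test_fun L (\<lambda>x. c)"
  by (rule test_funI(1)[where d = "\<lambda>x. 0"]) auto

lemma test_fun_add_const:
  assumes "test_fun L \<psi>"
  shows "test_fun L (\<lambda>x. \<psi> x + c)" "deriv (\<lambda>x. \<psi> x + c) = deriv \<psi>"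
proof -
  have d: "((\<lambda>x. \<psi> x + c) has_real_derivative deriv \<psi> x) (at x)" for x
    using DERIV_add[OF test_fun_D(1)[OF assms, of x] DERIV_const[of c]] by simp
  show "test_fun L (\<lambda>x. \<psi> x + c)" "deriv (\<lambda>x. \<psi> x + c) = deriv \<psi>"
    using test_funI[OF d test_fun_D(2)[OF assms]] test_fun_D(4)[OF assms] by auto
qed

text \<open>The antiderivative has to live on the whole line, because periodicity compares its
  values under arbitrary shifts.\<close>

lemma continuous_antiderivative:
  assumes "continuous_on UNIV (g :: real \<Rightarrow> real)"
  obtains G where "\<And>x. (G has_real_derivative g x) (at x)"
proof -
  have "\<exists>F. \<forall>x::real. - \<infinity> < ereal x \<longrightarrow> ereal x < \<infinity> \<longrightarrow> (F has_vector_derivative g x) (at x)"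
    using assms by (intro einterval_antiderivative) (auto simp: continuous_on_eq_continuous_at)
  then show ?thesis
    using that by (auto simp: has_real_derivative_iff_has_vector_derivative)
qed

lemma antiderivative_increment:
  fixes G g :: "real \<Rightarrow> real"
  assumes "\<And>x. (G has_real_derivative g x) (at x)" "a \<le> b"
  shows "(g has_integral (G b - G a)) {a..b}"
  using assms
  by (intro fundamental_theorem_of_calculus)
     (auto simp: has_real_derivative_iff_has_vector_derivative intro: has_vector_derivative_at_within)

lemma integral_torus_continuous:
  fixes g :: "real \<Rightarrow> 'a::euclidean_space"
  assumes "continuous_on UNIV g"
  shows "(LINT x|torus L. g x) = integral {0..L} g"
  using L2_integrable[OF L2_continuous[OF assms]]
  by (simp add: torus_def lebesgue_integral_eq_integral)

text \<open>The increment over a period has derivative 0. Consequently an antiderivative of a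
  periodic function is periodic once its increment \<open>G L - G 0\<close> vanishes.\<close>

lemma antiderivative_periodic_increment:
  assumes G: "\<And>x. (G has_real_derivative g x) (at x)" and g: "\<And>x. g (x + L) = g x"
  shows "G (x + L) - G x = G L - G 0"
proof -
  have "((\<lambda>x. G (x + L) - G x) has_real_derivative 0) (at y)" for y
    using DERIV_diff[OF G[of "y + L", unfolded DERIV_shift] G[of y]] g[of y] by simp
  then have "G (x + L) - G x = G (0 + L) - G 0"
    by (intro DERIV_isconst_all) auto
  then show ?thesis by simp
qed

section \<open>Approximation in L2 by bounded, continuous and test functions\<close>

lemma L2_approx_bounded:
  assumes "u \<in> L2 L" "0 < e"
  obtains v :: "real \<Rightarrow> real" and B where "v \<in> borel_measurable (torus L)" "\<And>x. \<bar>v x\<bar> \<le> B"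
    "L2_norm L (\<lambda>x. u x - v x) < e"
proof -
  note [measurable] = L2_D(1)[OF assms(1)]
  \<comment> \<open>Truncation at level \<open>n\<close> moves values towards 0, so the error is
    dominated by \<open>u\<close> itself.\<close>
  define v where "v n x = max (- real n) (min (real n) (u x))" for n x
  have "(\<lambda>n. L2_norm L (\<lambda>x. v n x - u x)) \<longlonglongrightarrow> 0"
  proof (rule L2_norm_tendsto_dominated)
    show "AE x in torus L. (\<lambda>n. v n x) \<longlonglongrightarrow> u x"
    proof (rule AE_I2)
      fix x
      have "\<forall>\<^sub>F n in sequentially. v n x = u x"
        using eventually_ge_at_top[of "nat \<lceil>\<bar>u x\<bar>\<rceil>"]
        by eventually_elim (auto simp: v_def)
      then show "(\<lambda>n. v n x) \<longlonglongrightarrow> u x" by (rule tendsto_eventually)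
    qed
  qed (use assms in \<open>auto simp: v_def\<close>)
  then have "\<forall>\<^sub>F n in sequentially. L2_norm L (\<lambda>x. v n x - u x) < e"
    using assms(2) by (rule order_tendstoD)
  then obtain n where "L2_norm L (\<lambda>x. v n x - u x) < e"
    by (auto simp: eventually_sequentially)
  moreover have "v n \<in> borel_measurable (torus L)" unfolding v_def by measurable
  ultimately show ?thesis
    by (intro that[of "v n" "real n"]) (auto simp: v_def L2_norm_diff_commute[of L u])
qed

text \<open>Measurability supplies continuous functions converging to \<open>u\<close> almost
  everywhere. Clamping them to the range of \<open>u\<close> provides a dominating constant, and a
  cutoff near the end points provides periodicity.\<close>

lemma L2_approx_continuous_periodic:
  fixes u :: "real \<Rightarrow> real"
  assumes u: "u \<in> borel_measurable (torus 1)" "\<And>x. \<bar>u x\<bar> \<le> B" and "0 < e"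
  obtains g where "continuous_on UNIV g" "\<And>x. g (x + 1) = g x"
    "L2_norm 1 (\<lambda>x. u x - g x) < e"
proof -
  have "u measurable_on {0..1}"
    using u(1) by (simp add: torus_def measurable_on_iff_borel_measurable)
  then obtain N f where N: "negligible N" and f: "\<And>n. continuous_on UNIV (f n)"
      "\<And>x. x \<notin> N \<Longrightarrow> (\<lambda>n. f n x) \<longlonglongrightarrow> (if x \<in> {0..1} then u x else 0)"
    unfolding measurable_on_def by blast
  have "0 \<le> B" using u(2)[of 0] by linarith
  \<comment> \<open>The cutoff vanishes at 0 and 1 and equals 1 at each interior point once
    \<open>n\<close> is large; it makes the end values of \<open>h n\<close> agree.\<close>
  define c where "c n x = min 1 (real n * (x * (1 - x)))" for n and x :: real
  define h where "h n x = c n x * max (- B) (min B (f n x))" for n x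
  define g where "g n x = h n (frac x)" for n x
  have h: "continuous_on S (h n)" for S n
    unfolding h_def c_def using f(1)[THEN continuous_on_subset] by (auto intro!: continuous_intros)
  then have g: "continuous_on UNIV (g n)" for n
    unfolding g_def by (intro continuous_on_periodic_extension) (auto simp: h_def c_def)
  have gh: "g n x = h n x" if "x \<in> {0..1}" for n x
    using that by (cases "x = 1") (auto simp: g_def h_def c_def frac_eq)
  have hB: "\<bar>h n x\<bar> \<le> 1 * B" if "x \<in> {0..1}" for n x
    unfolding h_def abs_mult using that \<open>0 \<le> B\<close>
    by (intro mult_mono) (auto simp: c_def abs_le_iff min_def max_def)
  have bound: "\<bar>h n x - u x\<bar> \<le> 2 * B" if "x \<in> {0..1}" for n x
    using hB[OF that, of n] u(2)[of x] by linarith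
  have "(\<lambda>n. L2_norm 1 (\<lambda>x. g n x - u x)) \<longlonglongrightarrow> 0"
  proof (rule L2_norm_tendsto_dominated)
    show "g n \<in> borel_measurable (torus 1)" for n
      using L2_D(1) L2_continuous g by blast
    show "(\<lambda>x. 2 * B) \<in> L2 1" by (rule L2_const)
    show "AE x in torus 1. norm (g n x - u x) \<le> norm (2 * B)" for n
      using bound gh \<open>0 \<le> B\<close> by (intro AE_I2) auto
    \<comment> \<open>The end points are discarded because the cutoff is 0 there for every
      \<open>n\<close>.\<close>
    have "negligible (N \<union> {0, 1})" using N by simp
    from AE_torus_not_in_negligible[OF this, of 1] AE_space[of "torus 1"]
    show "AE x in torus 1. (\<lambda>n. g n x) \<longlonglongrightarrow> u x"
    proof eventually_elim
      case (elim x)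
      then have x: "x \<in> {0..1}" "0 < x * (1 - x)" "x \<notin> N" by auto
      have "\<forall>\<^sub>F n in sequentially. c n x = 1"
        using eventually_ge_at_top[of "nat \<lceil>1 / (x * (1 - x))\<rceil>"]
      proof eventually_elim
        case (elim n)
        then have "1 / (x * (1 - x)) \<le> real n" by linarith
        then show ?case using x(2) by (simp add: c_def divide_le_eq min_def)
      qed
      then have "(\<lambda>n. c n x) \<longlonglongrightarrow> 1" by (rule tendsto_eventually)
      moreover have "(\<lambda>n. f n x) \<longlonglongrightarrow> u x" using f(2)[OF x(3)] x(1) by simp
      ultimately have "(\<lambda>n. h n x) \<longlonglongrightarrow> 1 * max (- B) (min B (u x))"
        unfolding h_def by (intro tendsto_intros)
      moreover have "max (- B) (min B (u x)) = u x" using u(2)[of x] by linarith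
      ultimately show ?case using gh[OF x(1)] by simp
    qed
  qed (rule u(1))
  then have "\<forall>\<^sub>F n in sequentially. L2_norm 1 (\<lambda>x. g n x - u x) < e"
    using assms(3) by (rule order_tendstoD)
  then obtain n where "L2_norm 1 (\<lambda>x. g n x - u x) < e"
    by (auto simp: eventually_sequentially)
  then show ?thesis
    by (intro that[OF g[of n]]) (auto simp: g_def frac_1_eq L2_norm_diff_commute[of 1 u])
qed

text \<open>A continuous function is approximated by its means over short intervals to the right.\<close>

lemma L2_approx_test_fun_of_continuous:
  assumes g: "continuous_on UNIV g" "\<And>x. g (x + 1) = g x" and "0 < e"
  obtains \<psi> where "test_fun 1 \<psi>" "L2_norm 1 (\<lambda>x. g x - \<psi> x) < e"
proof -
  obtain G where G: "\<And>x. (G has_real_derivative g x) (at x)"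
    using continuous_antiderivative[OF g(1)] by blast
  define \<delta> where "\<delta> n = 1 / real (Suc n)" for n
  have \<delta>: "0 < \<delta> n" "\<delta> n \<le> 1" for n by (auto simp: \<delta>_def)
  define \<psi> where "\<psi> n x = (G (x + \<delta> n) - G x) / \<delta> n" for n x
  \<comment> \<open>The increment of \<open>G\<close> over a period is a constant that cancels in
    the difference, so \<open>\<psi> n\<close> is periodic even where \<open>G\<close> is
    not.\<close>
  have per: "G (x + 1) = G x + (G 1 - G 0)" for x
    using antiderivative_periodic_increment[of G g 1 x] G g(2) by simp
  have test: "test_fun 1 (\<psi> n)" for n
  proof (rule test_funI(1))
    show "(\<psi> n has_real_derivative (g (x + \<delta> n) - g x) / \<delta> n) (at x)" for x
      unfolding \<psi>_def
      by (intro DERIV_cdivide DERIV_diff G G[of "x + \<delta> n", unfolded DERIV_shift])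
    show "continuous_on UNIV (\<lambda>x. (g (x + \<delta> n) - g x) / \<delta> n)"
      using g(1) \<delta>(1)[of n]
      by (intro continuous_intros continuous_on_compose2[OF g(1)]) (auto simp: \<delta>_def)
    show "\<psi> n (x + 1) = \<psi> n x" for x
      using per[of x] per[of "x + \<delta> n"] by (simp add: \<psi>_def ac_simps)
  qed
  have "compact (g ` {0..2})"
    using g(1) continuous_on_subset by (intro compact_continuous_image) auto
  then obtain B where B: "\<And>x. x \<in> {0..2} \<Longrightarrow> \<bar>g x\<bar> \<le> B"
    by (metis bounded_iff compact_imp_bounded imageI real_norm_def)
  have bound: "\<bar>\<psi> n x - g x\<bar> \<le> 2 * B" if x: "x \<in> {0..1}" for n x
  proof -
    \<comment> \<open>The mean over the interval is a value of \<open>g\<close> inside it, and such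
      an interval, of length at most 1, stays within \<open>{0..2}\<close>.\<close>
    obtain z where z: "x < z" "z < x + \<delta> n" "G (x + \<delta> n) - G x = (x + \<delta> n - x) * g z"
      using MVT2[of x "x + \<delta> n" G g] G \<delta>(1)[of n] by auto
    then have "\<psi> n x = g z" using \<delta>(1)[of n] by (simp add: \<psi>_def)
    moreover have "z \<in> {0..2}" using x z(1,2) \<delta>(2)[of n] by auto
    ultimately show ?thesis using B[of z] B[of x] x by auto
  qed
  have "(\<lambda>n. L2_norm 1 (\<lambda>x. \<psi> n x - g x)) \<longlonglongrightarrow> 0"
  proof (rule L2_norm_tendsto_dominated)
    show "\<psi> n \<in> borel_measurable (torus 1)" for n
      using L2_D(1) test_fun_L2(1)[OF test] by blast
    show "g \<in> borel_measurable (torus 1)" using L2_D(1) L2_continuous g(1) by blast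
    show "(\<lambda>x. 2 * B) \<in> L2 1" by (rule L2_const)
    show "AE x in torus 1. norm (\<psi> n x - g x) \<le> norm (2 * B)" for n
      using bound by (intro AE_I2) (metis abs_ge_self order_trans real_norm_def space_torus)
    have "(\<lambda>n. \<psi> n x) \<longlonglongrightarrow> g x" for x
    proof -
      have "filterlim \<delta> (at 0) sequentially"
        unfolding filterlim_at \<delta>_def using LIMSEQ_inverse_real_of_nat
        by (auto simp: inverse_eq_divide intro!: always_eventually)
      moreover have "((\<lambda>h. (G (x + h) - G x) / h) \<longlongrightarrow> g x) (at 0)"
        using G[of x] by (simp add: DERIV_def)
      ultimately show ?thesis unfolding \<psi>_def by (rule filterlim_compose[rotated])
    qed
    then show "AE x in torus 1. (\<lambda>n. \<psi> n x) \<longlonglongrightarrow> g x" by simp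
  qed
  then have "\<forall>\<^sub>F n in sequentially. L2_norm 1 (\<lambda>x. \<psi> n x - g x) < e"
    using assms(3) by (rule order_tendstoD)
  then obtain n where "L2_norm 1 (\<lambda>x. \<psi> n x - g x) < e"
    by (auto simp: eventually_sequentially)
  then show ?thesis
    by (intro that[OF test[of n]]) (simp add: L2_norm_diff_commute[of 1 g])
qed

lemma L2_approx_test_fun:
  fixes u :: "real \<Rightarrow> real"
  assumes u: "u \<in> L2 1" and "0 < e"
  obtains \<psi> where "test_fun 1 \<psi>" "L2_norm 1 (\<lambda>x. u x - \<psi> x) < e"
proof -
  have e: "0 < e / 3" using assms by simp
  obtain v B where v: "v \<in> borel_measurable (torus 1)" "\<And>x. \<bar>v x\<bar> \<le> B"
    "L2_norm 1 (\<lambda>x. u x - v x) < e / 3"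
    using L2_approx_bounded[OF u e] by blast
  obtain g where g: "continuous_on UNIV g" "\<And>x. g (x + 1) = g x"
    "L2_norm 1 (\<lambda>x. v x - g x) < e / 3"
    using L2_approx_continuous_periodic[OF v(1,2) e] by blast
  obtain \<psi> where \<psi>: "test_fun 1 \<psi>" "L2_norm 1 (\<lambda>x. g x - \<psi> x) < e / 3"
    using L2_approx_test_fun_of_continuous[OF g(1,2) e] by blast
  have "v \<in> L2 1" using v(1,2) by (intro L2_bounded) auto
  moreover have "g \<in> L2 1" by (rule L2_continuous[OF g(1)])
  moreover have "\<psi> \<in> L2 1" by (rule test_fun_L2(1)[OF \<psi>(1)])
  ultimately have "L2_norm 1 (\<lambda>x. u x - \<psi> x) < e"
    using L2_norm_triangle_diff[of u 1 v \<psi>] L2_norm_triangle_diff[of v 1 g \<psi>] u v(3) g(3) \<psi>(2)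
    by linarith
  then show ?thesis by (rule that[OF \<psi>(1)])
qed

text \<open>Derivatives of periodic functions have mean zero, so the approximant must lose its mean
  \<open>m\<close> before it is integrated. As \<open>u\<close> has mean zero, \<open>m\<close> is
  at most the approximation error, and the two errors share \<open>e\<close>. The normalization at 0
  is the one \<open>L2_norm_le_deriv\<close> asks for.\<close>

lemma L2_approx_deriv_test_fun:
  fixes u :: "real \<Rightarrow> real"
  assumes u: "u \<in> L2 1" "(LINT x|torus 1. u x) = 0" and "0 < e"
  obtains \<Phi> where "test_fun 1 \<Phi>" "\<Phi> 0 = 0" "L2_norm 1 (\<lambda>x. u x - deriv \<Phi> x) < e"
proof -
  obtain \<psi> where \<psi>: "test_fun 1 \<psi>" "L2_norm 1 (\<lambda>x. u x - \<psi> x) < e / 2"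
    using L2_approx_test_fun[OF u(1), of "e / 2"] assms(3) by auto
  note \<psi>L2 = test_fun_L2(1)[OF \<psi>(1), of 1]
  define m where "m = (LINT x|torus 1. \<psi> x)"
  define \<phi> where "\<phi> x = \<psi> x - m" for x
  have \<phi>: "continuous_on UNIV \<phi>" unfolding \<phi>_def
    using test_fun_D(3)[OF \<psi>(1)] by (intro continuous_intros)
  obtain G where G: "\<And>x. (G has_real_derivative \<phi> x) (at x)"
    using continuous_antiderivative[OF \<phi>] by blast
  define \<Phi> where "\<Phi> x = G x - G 0" for x
  have \<Phi>: "(\<Phi> has_real_derivative \<phi> x) (at x)" for x
    using DERIV_diff[OF G DERIV_const[of "G 0"]] by (simp add: \<Phi>_def[abs_def])
  have "G 1 - G 0 = (LINT x|torus 1. \<phi> x)"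
    using antiderivative_increment[OF G, of 0 1]
    by (simp add: integral_torus_continuous[OF \<phi>] integral_unique)
  also have "\<dots> = 0"
    using L2_integrable[OF \<psi>L2] measure_torus[of 1] by (simp add: \<phi>_def m_def)
  finally have "\<Phi> (x + 1) = \<Phi> x" for x
    using antiderivative_periodic_increment[OF G, of 1 x] test_fun_D(4)[OF \<psi>(1)]
    by (simp add: \<Phi>_def \<phi>_def)
  then have test: "test_fun 1 \<Phi>" "deriv \<Phi> = \<phi>"
    using test_funI[OF \<Phi> \<phi>] by auto
  have "\<bar>m\<bar> = \<bar>LINT x|torus 1. u x - \<psi> x\<bar>"
    using L2_integrable[OF \<psi>L2] L2_integrable[OF u(1)] u(2) by (simp add: m_def)
  also have "\<dots> < e / 2"
    using integral_le_L2_norm[OF L2_diff[OF u(1) \<psi>L2]] \<psi>(2) by simp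
  finally have "L2_norm 1 (\<lambda>x. m) < e / 2" by (simp add: L2_norm_const)
  then have "L2_norm 1 (\<lambda>x. (u x - \<psi> x) + m) < e"
    using L2_norm_triangle[OF L2_diff[OF u(1) \<psi>L2] L2_const[of m]] \<psi>(2) by linarith
  then show ?thesis
    by (intro that[OF test(1)]) (simp_all add: \<Phi>_def test(2) \<phi>_def algebra_simps)
qed

text \<open>Integrating from the zero at 0 bounds the supremum by the L1 norm of the derivative. The
  constant is 1 because the circle has length 1.\<close>

lemma L2_norm_le_deriv:
  assumes "test_fun 1 \<Phi>" "\<Phi> 0 = 0"
  shows "L2_norm 1 \<Phi> \<le> L2_norm 1 (deriv \<Phi>)"
proof -
  note d = test_fun_D(1,2)[OF assms(1)] and dL2 = test_fun_L2(2)[OF assms(1), of 1]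
  have int: "deriv \<Phi> integrable_on {a..b}" "(\<lambda>y. \<bar>deriv \<Phi> y\<bar>) integrable_on {a..b}" for a b
    using d(2) continuous_on_subset by (auto intro!: integrable_continuous_real continuous_intros)
  have "\<bar>\<Phi> x\<bar> \<le> L2_norm 1 (deriv \<Phi>)" if x: "x \<in> {0..1}" for x
  proof -
    have "\<bar>\<Phi> x\<bar> = \<bar>integral {0..x} (deriv \<Phi>)\<bar>"
      using antiderivative_increment[OF d(1), of 0 x] x assms(2) by (simp add: integral_unique)
    also have "\<dots> \<le> integral {0..x} (\<lambda>y. \<bar>deriv \<Phi> y\<bar>)"
      using int integral_norm_bound_integral[of "deriv \<Phi>" "{0..x}" "\<lambda>y. \<bar>deriv \<Phi> y\<bar>"] by simp
    also have "\<dots> \<le> integral {0..1} (\<lambda>y. \<bar>deriv \<Phi> y\<bar>)"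
      using int x by (intro integral_subset_le) auto
    also have "\<dots> = (LINT y|torus 1. norm (deriv \<Phi> y))"
      using d(2) by (subst integral_torus_continuous) (auto intro!: continuous_intros)
    also have "\<dots> \<le> L2_norm 1 (deriv \<Phi>)" by (rule L1_le_L2_norm[OF dL2])
    finally show ?thesis .
  qed
  then have "(LINT x|torus 1. (norm (\<Phi> x))\<^sup>2) \<le> (LINT x|torus 1. (L2_norm 1 (deriv \<Phi>))\<^sup>2)"
    using L2_D(2)[OF test_fun_L2(1)[OF assms(1)]]
    by (intro integral_mono) (auto simp: abs_le_square_iff[symmetric])
  then have "(L2_norm 1 \<Phi>)\<^sup>2 \<le> (L2_norm 1 (deriv \<Phi>))\<^sup>2"
    using measure_torus[of 1] by (simp add: L2_norm_square)
  then show ?thesis by (rule power2_le_imp_le) simp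
qed

section \<open>Weak derivatives\<close>

lemma L2_integrable_scaleR:
  fixes f :: "real \<Rightarrow> real" and u :: "real \<Rightarrow> 'a::euclidean_space"
  assumes "f \<in> L2 L" "u \<in> L2 L"
  shows "integrable (torus L) (\<lambda>x. f x *\<^sub>R u x)"
proof (rule Bochner_Integration.integrable_bound)
  note [measurable] = L2_D(1)[OF assms(1)] L2_D(1)[OF assms(2)]
  show "integrable (torus L) (\<lambda>x. norm (f x) \<bullet> norm (u x))"
    using assms by (intro L2_integrable_inner L2_norm_fun)
  show "(\<lambda>x. f x *\<^sub>R u x) \<in> borel_measurable (torus L)" by measurable
qed simp

lemma L2_integrable_test_fun_scaleR:
  assumes "test_fun L \<psi>" "u \<in> L2 L"
  shows "integrable (torus L) (\<lambda>x. \<psi> x *\<^sub>R u x)" "integrable (torus L) (\<lambda>x. deriv \<psi> x *\<^sub>R u x)"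
  using assms by (auto intro: L2_integrable_scaleR test_fun_L2)

text \<open>The density arguments are for scalar functions; pairing with a fixed vector carries
  their consequences over to curves.\<close>

lemma is_weak_deriv_inner:
  assumes "is_weak_deriv L u v" "u \<in> L2 L" "v \<in> L2 L"
  shows "is_weak_deriv L (\<lambda>x. u x \<bullet> b) (\<lambda>x. v x \<bullet> b)"
  unfolding is_weak_deriv_def
proof (intro allI impI)
  fix \<psi> assume \<psi>: "test_fun L \<psi>"
  have "(LINT x|torus L. deriv \<psi> x *\<^sub>R (u x \<bullet> b)) = (LINT x|torus L. (deriv \<psi> x *\<^sub>R u x) \<bullet> b)"
    by simp
  also have "\<dots> = (LINT x|torus L. deriv \<psi> x *\<^sub>R u x) \<bullet> b"
    using \<psi> assms(2) by (intro integral_inner_left L2_integrable_test_fun_scaleR)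
  also have "\<dots> = - ((LINT x|torus L. \<psi> x *\<^sub>R v x) \<bullet> b)"
    using \<psi> assms(1) by (simp add: is_weak_deriv_def)
  also have "(LINT x|torus L. \<psi> x *\<^sub>R v x) \<bullet> b = (LINT x|torus L. (\<psi> x *\<^sub>R v x) \<bullet> b)"
    using \<psi> assms(3) by (intro integral_inner_left[symmetric] L2_integrable_test_fun_scaleR)
  finally show "(LINT x|torus L. deriv \<psi> x *\<^sub>R (u x \<bullet> b)) = - (LINT x|torus L. \<psi> x *\<^sub>R (v x \<bullet> b))"
    by simp
qed

lemma is_weak_deriv_scaleR:
  fixes u v :: "real \<Rightarrow> 'a::euclidean_space"
  assumes "is_weak_deriv L u v"
  shows "is_weak_deriv L (\<lambda>x. c *\<^sub>R u x) (\<lambda>x. c *\<^sub>R v x)"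
proof -
  have "(LINT x|torus L. f x *\<^sub>R c *\<^sub>R w x) = c *\<^sub>R (LINT x|torus L. f x *\<^sub>R w x)"
    for f and w :: "real \<Rightarrow> 'a"
    by (simp only: integral_scaleR_right scaleR_left_commute[of _ c])
  then show ?thesis using assms by (simp add: is_weak_deriv_def del: scaleR_scaleR)
qed

lemma is_weak_deriv_diff:
  assumes "is_weak_deriv L u1 v1" "is_weak_deriv L u2 v2"
    and "u1 \<in> L2 L" "v1 \<in> L2 L" "u2 \<in> L2 L" "v2 \<in> L2 L"
  shows "is_weak_deriv L (\<lambda>x. u1 x - u2 x) (\<lambda>x. v1 x - v2 x)"
  using assms unfolding is_weak_deriv_def
  by (simp add: scaleR_diff_right L2_integrable_test_fun_scaleR)

text \<open>Needed for the initial curve, which agrees with the rescaled arclength parametrization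
  only almost everywhere.\<close>

lemma is_weak_deriv_cong_AE:
  assumes "is_weak_deriv L u v" "u \<in> borel_measurable (torus L)" "u' \<in> borel_measurable (torus L)"
    and "AE x in torus L. u x = u' x"
  shows "is_weak_deriv L u' v"
  unfolding is_weak_deriv_def
proof (intro allI impI)
  fix \<psi> assume \<psi>: "test_fun L \<psi>"
  note [measurable] = assms(2,3) L2_D(1)[OF test_fun_L2(2)[OF \<psi>]]
  have "(LINT x|torus L. deriv \<psi> x *\<^sub>R u' x) = (LINT x|torus L. deriv \<psi> x *\<^sub>R u x)"
    using assms(4) by (intro integral_cong_AE) auto
  then show "(LINT x|torus L. deriv \<psi> x *\<^sub>R u' x) = - (LINT x|torus L. \<psi> x *\<^sub>R v x)"
    using assms(1) \<psi> by (simp add: is_weak_deriv_def)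
qed

lemma is_weak_deriv_const: "0 \<le> L \<Longrightarrow> is_weak_deriv L (\<lambda>x. c) (\<lambda>x. 0)"
  unfolding is_weak_deriv_def
proof (intro allI impI)
  fix \<psi> assume "0 \<le> L" and \<psi>: "test_fun L \<psi>"
  have "(LINT x|torus L. deriv \<psi> x) = \<psi> L - \<psi> 0"
    using antiderivative_increment[OF test_fun_D(1)[OF \<psi>] \<open>0 \<le> L\<close>]
    by (simp add: integral_torus_continuous[OF test_fun_D(2)[OF \<psi>]] integral_unique)
  also have "\<dots> = 0" using test_fun_D(4)[OF \<psi>, of 0] by simp
  finally show "(LINT x|torus L. deriv \<psi> x *\<^sub>R c) = - (LINT x|torus L. \<psi> x *\<^sub>R 0)"
    using L2_integrable[OF test_fun_L2(2)[OF \<psi>], of L] by simp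
qed

text \<open>The product of two test functions takes equal values at 0 and \<open>L\<close>, so its
  derivative integrates to 0.\<close>

lemma is_weak_deriv_test_fun:
  assumes \<psi>: "test_fun L \<psi>" and "0 \<le> L"
  shows "is_weak_deriv L \<psi> (deriv \<psi>)"
  unfolding is_weak_deriv_def
proof (intro allI impI)
  fix \<phi> assume \<phi>: "test_fun L \<phi>"
  let ?d = "\<lambda>x. deriv \<phi> x * \<psi> x + \<phi> x * deriv \<psi> x"
  have "((\<lambda>x. \<phi> x * \<psi> x) has_real_derivative ?d x) (at x)" for x
    using DERIV_mult[OF test_fun_D(1)[OF \<phi>] test_fun_D(1)[OF \<psi>], of x] by (simp add: algebra_simps)
  from antiderivative_increment[OF this \<open>0 \<le> L\<close>]
  have "integral {0..L} ?d = 0"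
    using test_fun_D(4)[OF \<phi>, of 0] test_fun_D(4)[OF \<psi>, of 0] by (simp add: integral_unique)
  moreover have "continuous_on UNIV ?d"
    using test_fun_D(2,3)[OF \<phi>] test_fun_D(2,3)[OF \<psi>] by (intro continuous_intros)
  ultimately have "(LINT x|torus L. ?d x) = 0"
    by (simp add: integral_torus_continuous)
  moreover have "integrable (torus L) (\<lambda>x. deriv \<phi> x * \<psi> x)" "integrable (torus L) (\<lambda>x. \<phi> x * deriv \<psi> x)"
    using L2_integrable_test_fun_scaleR[OF \<phi> test_fun_L2(1)[OF \<psi>]]
      L2_integrable_test_fun_scaleR[OF \<phi> test_fun_L2(2)[OF \<psi>]] by simp_all
  ultimately show "(LINT x|torus L. deriv \<phi> x *\<^sub>R \<psi> x) = - (LINT x|torus L. \<phi> x *\<^sub>R deriv \<psi> x)"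
    by simp
qed

lemma L2_norm_square_inner: "(L2_norm L u)\<^sup>2 = (LINT x|torus L. u x \<bullet> u x)"
  by (simp add: L2_norm_square power2_norm_eq_inner)

text \<open>The fundamental lemma of the calculus of variations. If \<open>w\<close> had positive
  norm, a test function \<open>\<psi>\<close> closer to \<open>w\<close> than this norm would exist,
  and orthogonality would give that the squared norm of \<open>w\<close> equals (w - \<psi>, w),
  which is strictly smaller.\<close>

lemma L2_orthogonal_test_fun_imp_AE_0:
  fixes w :: "real \<Rightarrow> real"
  assumes w: "w \<in> L2 1" and 0: "\<And>\<psi>. test_fun 1 \<psi> \<Longrightarrow> (LINT x|torus 1. \<psi> x * w x) = 0"
  shows "AE x in torus 1. w x = 0"
proof (rule L2_norm_eq_0_imp_AE[OF w], rule ccontr)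
  assume "L2_norm 1 w \<noteq> 0"
  then have pos: "0 < L2_norm 1 w" by (simp add: less_le)
  obtain \<psi> where \<psi>: "test_fun 1 \<psi>" "L2_norm 1 (\<lambda>x. w x - \<psi> x) < L2_norm 1 w"
    using L2_approx_test_fun[OF w pos] .
  note \<psi>L2 = test_fun_L2(1)[OF \<psi>(1), of 1]
  have "(LINT x|torus 1. (w x - \<psi> x) \<bullet> w x) = (LINT x|torus 1. w x \<bullet> w x) - (LINT x|torus 1. \<psi> x \<bullet> w x)"
    using L2_integrable_inner[OF w w] L2_integrable_inner[OF \<psi>L2 w] by (simp add: left_diff_distrib)
  also have "\<dots> = (L2_norm 1 w)\<^sup>2"
    using 0[OF \<psi>(1)] by (simp add: L2_norm_square_inner)
  finally have "(L2_norm 1 w)\<^sup>2 \<le> L2_norm 1 (\<lambda>x. w x - \<psi> x) * L2_norm 1 w"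
    using L2_Cauchy_Schwarz[OF L2_diff[OF w \<psi>L2] w] by simp
  also have "\<dots> < L2_norm 1 w * L2_norm 1 w"
    using \<psi>(2) pos by (rule mult_strict_right_mono)
  finally show False by (simp add: power2_eq_square)
qed

text \<open>The difference of two weak derivatives is orthogonal to all test functions, component by
  component. This is what makes the choice in \<open>wderiv\<close> harmless under
  integrals.\<close>

lemma weak_deriv_unique:
  fixes u :: "real \<Rightarrow> 'a::euclidean_space"
  assumes u: "u \<in> L2 1" and v: "v \<in> L2 1" "is_weak_deriv 1 u v" and v': "v' \<in> L2 1" "is_weak_deriv 1 u v'"
  shows "AE x in torus 1. v x = v' x"
proof -
  have "AE x in torus 1. (v x - v' x) \<bullet> b = 0" for b :: 'a
  proof (rule L2_orthogonal_test_fun_imp_AE_0)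
    show "(\<lambda>x. (v x - v' x) \<bullet> b) \<in> L2 1"
      by (intro L2_inner_const L2_diff v v')
    fix \<psi> assume \<psi>: "test_fun 1 \<psi>"
    note i = L2_integrable_test_fun_scaleR(1)[OF \<psi> L2_inner_const[OF v(1), of b]]
      L2_integrable_test_fun_scaleR(1)[OF \<psi> L2_inner_const[OF v'(1), of b]]
    show "(LINT x|torus 1. \<psi> x * ((v x - v' x) \<bullet> b)) = 0"
      using is_weak_deriv_inner[OF v(2) u v(1), of b] is_weak_deriv_inner[OF v'(2) u v'(1), of b] i \<psi>
      by (simp add: is_weak_deriv_def inner_diff_left right_diff_distrib)
  qed
  then have "AE x in torus 1. \<forall>b\<in>Basis. (v x - v' x) \<bullet> b = 0"
    by (intro AE_finite_allI) auto
  then show ?thesis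
    by eventually_elim (simp add: euclidean_eq_iff[of "v _"] inner_diff_left)
qed

text \<open>The constant 1 is a periodic test function.\<close>

lemma weak_deriv_integral_0:
  assumes "is_weak_deriv L u (v :: real \<Rightarrow> real)"
  shows "(LINT x|torus L. v x) = 0"
proof -
  have "deriv (\<lambda>x::real. 1::real) = (\<lambda>x. 0)" by (intro ext) simp
  then show ?thesis
    using assms test_fun_const[of L 1] unfolding is_weak_deriv_def by fastforce
qed

text \<open>
  By duality: the norm of \<open>u\<close> is approached by pairing it with functions \<open>\<Phi>'\<close>, and pairing
  \<open>u\<close> with \<open>\<Phi>'\<close> amounts to pairing \<open>v\<close> with \<open>\<Phi>\<close>, whose norm is at most that of \<open>\<Phi>'\<close>.
\<close>

lemma weak_Poincare:
  fixes u v :: "real \<Rightarrow> real"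
  assumes u: "u \<in> L2 1" "(LINT x|torus 1. u x) = 0" and v: "v \<in> L2 1" and d: "is_weak_deriv 1 u v"
  shows "L2_norm 1 u \<le> L2_norm 1 v"
proof (cases "L2_norm 1 u = 0")
  case False
  then have pos: "0 < L2_norm 1 u" by (simp add: less_le)
  let ?a = "L2_norm 1 u" and ?b = "L2_norm 1 v"
  have "?a\<^sup>2 \<le> ?a * ?b + e * (?a + ?b)" if "0 < e" for e
  proof -
    obtain \<Phi> where \<Phi>: "test_fun 1 \<Phi>" "\<Phi> 0 = 0" "L2_norm 1 (\<lambda>x. u x - deriv \<Phi> x) < e"
      using L2_approx_deriv_test_fun[OF u \<open>0 < e\<close>] .
    note \<Phi>L2 = test_fun_L2[OF \<Phi>(1), of 1]
    have "?a\<^sup>2 = (LINT x|torus 1. (u x - deriv \<Phi> x) \<bullet> u x) + (LINT x|torus 1. deriv \<Phi> x \<bullet> u x)"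
      using L2_integrable_inner[OF u(1) u(1)] L2_integrable_inner[OF \<Phi>L2(2) u(1)]
      by (simp add: left_diff_distrib L2_norm_square_inner)
    also have "(LINT x|torus 1. deriv \<Phi> x \<bullet> u x) = - (LINT x|torus 1. \<Phi> x \<bullet> v x)"
      using d \<Phi>(1) by (simp add: is_weak_deriv_def)
    also have "(LINT x|torus 1. (u x - deriv \<Phi> x) \<bullet> u x) + - (LINT x|torus 1. \<Phi> x \<bullet> v x)
        \<le> L2_norm 1 (\<lambda>x. u x - deriv \<Phi> x) * ?a + L2_norm 1 \<Phi> * ?b"
      using L2_Cauchy_Schwarz[OF L2_diff[OF u(1) \<Phi>L2(2)] u(1)] L2_Cauchy_Schwarz[OF \<Phi>L2(1) v]
      by linarith
    also have "\<dots> \<le> e * ?a + (?a + e) * ?b"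
    proof (intro add_mono mult_right_mono)
      have "L2_norm 1 (deriv \<Phi>) \<le> ?a + L2_norm 1 (\<lambda>x. u x - deriv \<Phi> x)"
        using L2_norm_le_of_close[OF \<Phi>L2(2) u(1)] by (simp add: L2_norm_diff_commute[of 1 u])
      then show "L2_norm 1 \<Phi> \<le> ?a + e"
        using L2_norm_le_deriv[OF \<Phi>(1,2)] \<Phi>(3) by linarith
    qed (use \<Phi>(3) in auto)
    finally show ?thesis by (simp add: algebra_simps)
  qed
  \<comment> \<open>Since \<open>?a + ?b\<close> is positive, the slack \<open>e * (?a + ?b)\<close>
    can be made any positive number.\<close>
  then have "?a\<^sup>2 \<le> ?a * ?b + e" if "0 < e" for e
    using that pos L2_norm_nonneg[of 1 v]
    by (metis add_pos_nonneg divide_pos_pos nonzero_eq_divide_eq order_less_irrefl)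
  then have "?a\<^sup>2 \<le> ?a * ?b" by (rule field_le_epsilon)
  then show ?thesis using pos by (simp add: power2_eq_square)
qed simp

text \<open>Only the derivative is approximated directly. After the means have been matched, the
  Poincare inequality applied to \<open>u - \<psi>\<close> bounds the error of the function by that
  of the derivative.\<close>

lemma H1_approx_test_fun:
  fixes u v :: "real \<Rightarrow> real"
  assumes u: "u \<in> L2 1" and v: "v \<in> L2 1" and d: "is_weak_deriv 1 u v" and "0 < e"
  obtains \<psi> where "test_fun 1 \<psi>" "L2_norm 1 (\<lambda>x. u x - \<psi> x) < e"
    "L2_norm 1 (\<lambda>x. v x - deriv \<psi> x) < e"
proof -
  obtain \<Phi> where \<Phi>: "test_fun 1 \<Phi>" "L2_norm 1 (\<lambda>x. v x - deriv \<Phi> x) < e"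
    using L2_approx_deriv_test_fun[OF v weak_deriv_integral_0[OF d] \<open>0 < e\<close>] .
  \<comment> \<open>The shift by \<open>c\<close> gives \<open>\<psi>\<close> the mean of
    \<open>u\<close> and leaves the derivative unchanged.\<close>
  define c where "c = (LINT x|torus 1. u x) - (LINT x|torus 1. \<Phi> x)"
  define \<psi> where "\<psi> x = \<Phi> x + c" for x
  have \<psi>: "test_fun 1 \<psi>" "deriv \<psi> = deriv \<Phi>"
    unfolding \<psi>_def using test_fun_add_const[OF \<Phi>(1)] by auto
  note \<psi>L2 = test_fun_L2[OF \<psi>(1), of 1]
  have "(LINT x|torus 1. u x - \<psi> x) = 0"
    using L2_integrable[OF u] L2_integrable[OF test_fun_L2(1)[OF \<Phi>(1), of 1]] measure_torus[of 1]
    by (simp add: \<psi>_def c_def)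
  then have "L2_norm 1 (\<lambda>x. u x - \<psi> x) \<le> L2_norm 1 (\<lambda>x. v x - deriv \<psi> x)"
    using u v d \<psi>L2 is_weak_deriv_test_fun[OF \<psi>(1)]
    by (intro weak_Poincare L2_diff is_weak_deriv_diff) auto
  then show ?thesis using \<Phi>(2) \<psi> by (intro that[OF \<psi>(1)]) auto
qed

text \<open>With a test function in place of \<open>u\<close> the identity is the definition of the
  weak derivative of \<open>v\<close>. By density of test functions in H1, the remaining error is at
  most any \<open>e\<close> times a constant.\<close>

lemma weak_integration_by_parts:
  fixes u v :: "real \<Rightarrow> real"
  assumes "u \<in> L2 1" "u' \<in> L2 1" "is_weak_deriv 1 u u'" "v \<in> L2 1" "v' \<in> L2 1" "is_weak_deriv 1 v v'"
  shows "(LINT x|torus 1. u x * v' x) = - (LINT x|torus 1. u' x * v x)"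
proof -
  let ?s = "(LINT x|torus 1. u x * v' x) + (LINT x|torus 1. u' x * v x)"
  let ?K = "L2_norm 1 v + L2_norm 1 v'"
  have "\<bar>?s\<bar> \<le> e * ?K" if "0 < e" for e
  proof -
    obtain \<psi> where \<psi>: "test_fun 1 \<psi>" "L2_norm 1 (\<lambda>x. u x - \<psi> x) < e"
      "L2_norm 1 (\<lambda>x. u' x - deriv \<psi> x) < e"
      using H1_approx_test_fun[OF assms(1-3) \<open>0 < e\<close>] .
    note \<psi>L2 = test_fun_L2[OF \<psi>(1), of 1]
    have "?s = (LINT x|torus 1. (u x - \<psi> x) \<bullet> v' x) + (LINT x|torus 1. (u' x - deriv \<psi> x) \<bullet> v x)
        + ((LINT x|torus 1. \<psi> x \<bullet> v' x) + (LINT x|torus 1. deriv \<psi> x \<bullet> v x))"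
      using L2_integrable_inner[OF assms(1,5)] L2_integrable_inner[OF assms(2,4)]
        L2_integrable_inner[OF \<psi>L2(1) assms(5)] L2_integrable_inner[OF \<psi>L2(2) assms(4)]
      by (simp add: left_diff_distrib)
    also have "(LINT x|torus 1. \<psi> x \<bullet> v' x) + (LINT x|torus 1. deriv \<psi> x \<bullet> v x) = 0"
      using assms(6) \<psi>(1) by (simp add: is_weak_deriv_def)
    finally have "\<bar>?s\<bar> \<le> L2_norm 1 (\<lambda>x. u x - \<psi> x) * L2_norm 1 v'
        + L2_norm 1 (\<lambda>x. u' x - deriv \<psi> x) * L2_norm 1 v"
      using L2_Cauchy_Schwarz[OF L2_diff[OF assms(1) \<psi>L2(1)] assms(5)]
        L2_Cauchy_Schwarz[OF L2_diff[OF assms(2) \<psi>L2(2)] assms(4)] by linarith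
    also have "\<dots> \<le> e * L2_norm 1 v' + e * L2_norm 1 v"
      using \<psi>(2,3) by (intro add_mono mult_right_mono) auto
    finally show ?thesis by (simp add: algebra_simps)
  qed
  note bound = this
  have "\<bar>?s\<bar> \<le> 0 + e" if "0 < e" for e
  proof -
    \<comment> \<open>\<open>?K\<close> may be 0, so \<open>?K + 1\<close> is used as the
      divisor.\<close>
    have K: "0 < ?K + 1" using L2_norm_nonneg[of 1 v] L2_norm_nonneg[of 1 v'] by linarith
    have "\<bar>?s\<bar> \<le> e / (?K + 1) * ?K"
      using \<open>0 < e\<close> K by (intro bound) simp
    also have "\<dots> \<le> e" using \<open>0 < e\<close> K by (simp add: field_simps)
    finally show ?thesis by simp
  qed
  then have "\<bar>?s\<bar> \<le> 0" by (rule field_le_epsilon)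
  then show ?thesis by simp
qed

section \<open>The chosen weak derivative\<close>

lemma wderiv_H1:
  assumes "u \<in> H1 L"
  shows "u \<in> L2 L" "wderiv L u \<in> L2 L" "is_weak_deriv L u (wderiv L u)"
proof -
  have "\<exists>v. v \<in> L2 L \<and> is_weak_deriv L u v" using assms by (auto simp: H1_def)
  then have "wderiv L u \<in> L2 L \<and> is_weak_deriv L u (wderiv L u)"
    unfolding wderiv_def by (rule someI_ex)
  then show "wderiv L u \<in> L2 L" "is_weak_deriv L u (wderiv L u)" by auto
  show "u \<in> L2 L" using assms by (simp add: H1_def)
qed

lemma H1_I: "u \<in> L2 L \<Longrightarrow> v \<in> L2 L \<Longrightarrow> is_weak_deriv L u v \<Longrightarrow> u \<in> H1 L"
  by (auto simp: H1_def)

text \<open>The way to evaluate the choice: exhibit any weak derivative and appeal to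
  uniqueness.\<close>

lemma wderiv_AE_eq:
  assumes "u \<in> L2 1" "v \<in> L2 1" "is_weak_deriv 1 u v"
  shows "AE x in torus 1. wderiv 1 u x = v x"
  using wderiv_H1[OF H1_I[OF assms]] assms by (intro weak_deriv_unique[of u])

lemma H1_diff: "u \<in> H1 L \<Longrightarrow> v \<in> H1 L \<Longrightarrow> (\<lambda>x. u x - v x) \<in> H1 L"
  by (rule H1_I[OF L2_diff L2_diff is_weak_deriv_diff[OF wderiv_H1(3) wderiv_H1(3)]])
     (auto intro: wderiv_H1)

lemma H1_scaleR: "u \<in> H1 L \<Longrightarrow> (\<lambda>x. c *\<^sub>R u x) \<in> H1 L"
  by (rule H1_I[OF L2_scaleR L2_scaleR is_weak_deriv_scaleR[OF wderiv_H1(3)]]) (auto intro: wderiv_H1)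

lemma H1_const: "0 \<le> L \<Longrightarrow> (\<lambda>x. c) \<in> H1 L"
  by (rule H1_I[OF L2_const L2_const is_weak_deriv_const])

lemma wderiv_const: "AE x in torus 1. wderiv 1 (\<lambda>x. c) x = 0"
  by (rule wderiv_AE_eq[OF L2_const L2_const is_weak_deriv_const]) simp

lemma wderiv_diff:
  assumes "u \<in> H1 1" "v \<in> H1 1"
  shows "AE x in torus 1. wderiv 1 (\<lambda>x. u x - v x) x = wderiv 1 u x - wderiv 1 v x"
  using wderiv_H1[OF assms(1)] wderiv_H1[OF assms(2)]
  by (intro wderiv_AE_eq L2_diff is_weak_deriv_diff)

lemma wderiv_scaleR:
  assumes "u \<in> H1 1"
  shows "AE x in torus 1. wderiv 1 (\<lambda>x. c *\<^sub>R u x) x = c *\<^sub>R wderiv 1 u x"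
  using wderiv_H1[OF assms] by (intro wderiv_AE_eq L2_scaleR is_weak_deriv_scaleR)

lemma wderiv_inner:
  assumes "u \<in> H1 1"
  shows "AE x in torus 1. wderiv 1 (\<lambda>x. u x \<bullet> b) x = wderiv 1 u x \<bullet> b"
  using wderiv_H1[OF assms] by (intro wderiv_AE_eq L2_inner_const is_weak_deriv_inner)

lemma L2_norm_le_H1_norm:
  "L2_norm L u \<le> H1_norm L u" "L2_norm L (wderiv L u) \<le> H1_norm L u"
  by (auto simp: L2_norm_def H1_norm_def)

section \<open>Change of period\<close>

lemma torus_scale:
  fixes f :: "real \<Rightarrow> 'a::euclidean_space"
  assumes L: "0 < L" and f: "f \<in> borel_measurable (torus L)"
  shows "(\<lambda>x. f (L * x)) \<in> borel_measurable (torus 1)"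
    and "integrable (torus L) f \<longleftrightarrow> integrable (torus 1) (\<lambda>x. f (L * x))"
    and "(LINT x|torus L. f x) = L *\<^sub>R (LINT x|torus 1. f (L * x))"
proof -
  let ?F = "\<lambda>x. indicator {0..L} x *\<^sub>R f x"
  have m: "(*) L \<in> lebesgue \<rightarrow>\<^sub>M lebesgue"
    using lebesgue_measurable_scaling[where 'a = real, of L] by (simp add: real_scaleR_def[abs_def])
  \<comment> \<open>Multiplication by \<open>L\<close> pulls \<open>{0..L}\<close> back to
    \<open>{0..1}\<close>, which reduces the claim to integrals over the whole line.\<close>
  have ind: "indicat_real {0..L} (L * x) = indicat_real {0..1} x" for x
    using L by (auto simp: indicator_def zero_le_mult_iff)
  have F: "?F \<in> borel_measurable lebesgue"
    using f borel_measurable_restrict_space_iff[of "{0..L}" lebesgue f] by (simp add: torus_def)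
  then have FL: "(\<lambda>x. indicator {0..1} x *\<^sub>R f (L * x)) \<in> borel_measurable lebesgue"
    using measurable_comp[OF m F] by (simp add: o_def ind)
  then show "(\<lambda>x. f (L * x)) \<in> borel_measurable (torus 1)"
    using borel_measurable_restrict_space_iff[of "{0..1}" lebesgue "\<lambda>x. f (L * x)"]
    by (simp add: torus_def)
  have F2: "(\<lambda>x. L *\<^sub>R ?F x) \<in> borel_measurable lebesgue"
    by (rule borel_measurable_scaleR[OF _ F]) simp
  have F': "?F \<in> borel_measurable (distr lebesgue lebesgue ((*) L))" using F by simp
  \<comment> \<open>The image of Lebesgue measure under multiplication by \<open>L\<close> is
    Lebesgue measure divided by \<open>L\<close>; the density \<open>L\<close> restores it.\<close>
  have dens: "lebesgue = density (distr lebesgue lebesgue ((*) L)) (\<lambda>x. ennreal L)"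
    using lebesgue_real_scale[of L] L by simp
  have scale_iff: "integrable lebesgue (\<lambda>x. L *\<^sub>R g x) \<longleftrightarrow> integrable lebesgue g" for g :: "real \<Rightarrow> 'a"
    using integrable_scaleR_right[of "inverse L" lebesgue "\<lambda>x. L *\<^sub>R g x"]
      integrable_scaleR_right[of L lebesgue g] L by auto
  have "integrable lebesgue ?F \<longleftrightarrow> integrable (distr lebesgue lebesgue ((*) L)) (\<lambda>x. L *\<^sub>R ?F x)"
    using F' L by (subst dens, subst integrable_density) auto
  also have "\<dots> \<longleftrightarrow> integrable lebesgue (\<lambda>x. L *\<^sub>R ?F (L * x))"
    by (intro integrable_distr_eq m F2)
  finally show "integrable (torus L) f \<longleftrightarrow> integrable (torus 1) (\<lambda>x. f (L * x))"
    by (simp add: torus_def integrable_restrict_space ind scale_iff del: scaleR_scaleR)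
  have "(LINT x|lebesgue. ?F x) = (LINT x|distr lebesgue lebesgue ((*) L). L *\<^sub>R ?F x)"
    using F' L by (subst dens, subst integral_density) auto
  also have "\<dots> = (LINT x|lebesgue. L *\<^sub>R ?F (L * x))"
    by (intro integral_distr m F2)
  finally show "(LINT x|torus L. f x) = L *\<^sub>R (LINT x|torus 1. f (L * x))"
    by (simp add: torus_def integral_restrict_space ind del: scaleR_scaleR)
qed

lemma L2_torus_scale:
  assumes "0 < L" "u \<in> L2 L"
  shows "(\<lambda>x. u (L * x)) \<in> L2 1"
proof -
  note [measurable] = L2_D(1)[OF assms(2)]
  have "(\<lambda>x. (norm (u x))\<^sup>2) \<in> borel_measurable (torus L)" by measurable
  then show ?thesis
    using torus_scale(1)[OF assms(1) L2_D(1)[OF assms(2)]]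
      torus_scale(2)[OF assms(1), of "\<lambda>x. (norm (u x))\<^sup>2"] L2_D(2)[OF assms(2)]
    by (simp add: L2_def)
qed

text \<open>A test function of period 1 is stretched to period \<open>L\<close>. The factor 1/L of
  its derivative cancels the Jacobian in the integral with \<open>u\<close>; in the integral with
  \<open>v\<close> the Jacobian survives and becomes the factor of the new derivative.\<close>

lemma is_weak_deriv_torus_scale:
  assumes L: "0 < L" and u: "u \<in> L2 L" and v: "v \<in> L2 L" and d: "is_weak_deriv L u v"
  shows "is_weak_deriv 1 (\<lambda>x. u (L * x)) (\<lambda>x. L *\<^sub>R v (L * x))"
  unfolding is_weak_deriv_def
proof (intro allI impI)
  fix \<psi> assume \<psi>: "test_fun 1 \<psi>"
  let ?\<phi> = "\<lambda>x. \<psi> (x / L)"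
  have "(?\<phi> has_real_derivative deriv \<psi> (x / L) / L) (at x)" for x
    using DERIV_chain2[OF test_fun_D(1)[OF \<psi>, of "x / L"] DERIV_cdivide[OF DERIV_ident]] by simp
  moreover have "continuous_on UNIV (\<lambda>x. deriv \<psi> (x / L) / L)"
    using L by (intro continuous_intros continuous_on_compose2[OF test_fun_D(2)[OF \<psi>]]) auto
  moreover have "?\<phi> (x + L) = ?\<phi> x" for x
    using L test_fun_D(4)[OF \<psi>, of "x / L"] by (simp add: add_divide_distrib)
  ultimately have \<phi>: "test_fun L ?\<phi>" "deriv ?\<phi> = (\<lambda>x. deriv \<psi> (x / L) / L)"
    using test_funI[of ?\<phi> "\<lambda>x. deriv \<psi> (x / L) / L" L] by simp_all
  note meas [measurable] = L2_D(1)[OF u] L2_D(1)[OF v] L2_D(1)[OF test_fun_L2(1)[OF \<phi>(1)]]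
    L2_D(1)[OF test_fun_L2(2)[OF \<phi>(1)]]
  have "(LINT x|torus L. deriv ?\<phi> x *\<^sub>R u x) = L *\<^sub>R (LINT x|torus 1. deriv ?\<phi> (L * x) *\<^sub>R u (L * x))"
    by (rule torus_scale(3)[OF L]) measurable
  also have "\<dots> = (LINT x|torus 1. deriv \<psi> x *\<^sub>R u (L * x))"
    using L by (simp add: \<phi>(2) flip: integral_scaleR_right)
  finally have 1: "(LINT x|torus L. deriv ?\<phi> x *\<^sub>R u x) = (LINT x|torus 1. deriv \<psi> x *\<^sub>R u (L * x))" .
  have "(LINT x|torus L. ?\<phi> x *\<^sub>R v x) = L *\<^sub>R (LINT x|torus 1. ?\<phi> (L * x) *\<^sub>R v (L * x))"
    by (rule torus_scale(3)[OF L]) measurable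
  also have "\<dots> = (LINT x|torus 1. \<psi> x *\<^sub>R (L *\<^sub>R v (L * x)))"
    using L by (simp add: mult.commute flip: integral_scaleR_right)
  finally show "(LINT x|torus 1. deriv \<psi> x *\<^sub>R u (L * x)) = - (LINT x|torus 1. \<psi> x *\<^sub>R (L *\<^sub>R v (L * x)))"
    using d \<phi>(1) 1 by (simp add: is_weak_deriv_def)
qed

section \<open>Anisotropic energy densities\<close>

lemma perp_nth [simp]: "perp v $ 1 = v $ 2" "perp v $ 2 = - v $ 1"
  by (simp_all add: perp_def)

lemma linear_perp: "linear perp"
  by (rule linearI) (simp_all add: vec_eq_iff forall_2)

lemma norm_perp [simp]: "norm (perp v) = norm v"
  by (simp add: norm_eq_sqrt_inner inner_vec_def sum_2)

lemma perp_eq_0_iff [simp]: "perp v = 0 \<longleftrightarrow> v = 0"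
  by (metis norm_eq_zero norm_perp)

lemma perp_scaleR: "perp (c *\<^sub>R v) = c *\<^sub>R perp v"
  by (rule linear_scale[OF linear_perp])

lemma perp_diff: "perp (u - v) = perp u - perp v"
  by (rule linear_diff[OF linear_perp])

lemma bounded_linear_perp: "bounded_linear perp"
  using linear_perp by (simp add: linear_linear)

lemma hom_ext_scaleR: "0 < c \<Longrightarrow> hom_ext \<gamma> (c *\<^sub>R p) = c * hom_ext \<gamma> p"
  by (auto simp: hom_ext_def field_simps)

lemma hom_ext_sphere: "norm n = 1 \<Longrightarrow> hom_ext \<gamma> n = \<gamma> n"
  by (auto simp: hom_ext_def)

text \<open>This justifies the definite description in \<open>xi\<close>.\<close>

lemma GDERIV_unique:
  fixes f :: "'a::euclidean_space \<Rightarrow> real"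
  assumes "GDERIV f x :> D" "GDERIV f x :> E"
  shows "D = E"
proof -
  have "(\<lambda>h. inner h D) = (\<lambda>h. inner h E)"
    using assms unfolding gderiv_def by (rule has_derivative_unique)
  then show ?thesis by (metis vector_eq_ldot)
qed

lemma differentiable_imp_GDERIV:
  fixes f :: "'a::euclidean_space \<Rightarrow> real"
  assumes "f differentiable (at x)"
  obtains D where "GDERIV f x :> D"
proof -
  obtain f' where f': "(f has_derivative f') (at x)"
    using assms by (auto simp: differentiable_def)
  have "f' h = inner h (\<Sum>b\<in>Basis. f' b *\<^sub>R b)" for h
  proof -
    have "linear f'" using f' by (rule has_derivative_linear)
    then have "f' (\<Sum>b\<in>Basis. inner h b *\<^sub>R b) = (\<Sum>b\<in>Basis. inner h b * f' b)"
      by (simp add: linear_sum linear_scale)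
    then show ?thesis by (simp add: euclidean_representation inner_sum_right mult.commute)
  qed
  then have "f' = (\<lambda>h. inner h (\<Sum>b\<in>Basis. f' b *\<^sub>R b))" by blast
  with f' show ?thesis using that unfolding gderiv_def by metis
qed

lemma GDERIV_xi:
  assumes "surface_energy \<gamma>" "norm n = 1"
  shows "GDERIV (hom_ext \<gamma>) n :> xi \<gamma> n"
proof -
  have "hom_ext \<gamma> differentiable (at n)" using assms by (simp add: surface_energy_def)
  then obtain D where "GDERIV (hom_ext \<gamma>) n :> D" by (rule differentiable_imp_GDERIV)
  then show ?thesis unfolding xi_def
    by (rule theI) (rule GDERIV_unique[OF _ \<open>GDERIV (hom_ext \<gamma>) n :> D\<close>])
qed

text \<open>The gradient is homogeneous of degree 0: with the scale \<open>norm p\<close> frozen,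
  \<open>hom_ext \<gamma> q\<close> is that scale times the value at the rescaled \<open>q\<close>,
  to which the chain rule applies at a unit vector.\<close>

lemma GDERIV_hom_ext:
  assumes "surface_energy \<gamma>" "p \<noteq> 0"
  shows "GDERIV (hom_ext \<gamma>) p :> xi \<gamma> (p /\<^sub>R norm p)"
proof -
  let ?c = "norm p" and ?n = "p /\<^sub>R norm p"
  have "((\<lambda>q. q /\<^sub>R ?c) has_derivative (\<lambda>h. h /\<^sub>R ?c)) (at p)"
    by (rule bounded_linear.has_derivative[OF bounded_linear_scaleR_right has_derivative_ident])
  moreover have "(hom_ext \<gamma> has_derivative (\<lambda>h. inner h (xi \<gamma> ?n))) (at ?n)"
    using GDERIV_xi[OF assms(1), of ?n] assms(2) by (simp add: gderiv_def)
  ultimately have "((\<lambda>q. hom_ext \<gamma> (q /\<^sub>R ?c)) has_derivative (\<lambda>h. inner (h /\<^sub>R ?c) (xi \<gamma> ?n))) (at p)"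
    by (rule has_derivative_compose)
  then have "((\<lambda>q. ?c * hom_ext \<gamma> (q /\<^sub>R ?c)) has_derivative
      (\<lambda>h. ?c * inner (h /\<^sub>R ?c) (xi \<gamma> ?n))) (at p)"
    by (rule has_derivative_mult_right)
  moreover have "?c * hom_ext \<gamma> (q /\<^sub>R ?c) = hom_ext \<gamma> q" for q
    using hom_ext_scaleR[of "inverse ?c" \<gamma> q] assms(2) by simp
  ultimately show ?thesis using assms(2) by (simp add: gderiv_def mult.assoc[symmetric])
qed

lemma inner_xi_self:
  assumes "surface_energy \<gamma>" "norm n = 1"
  shows "n \<bullet> xi \<gamma> n = \<gamma> n"
proof -
  have "((\<lambda>t. t *\<^sub>R n) has_derivative (\<lambda>t. t *\<^sub>R n)) (at 1)"
    by (rule bounded_linear.has_derivative[OF bounded_linear_scaleR_left has_derivative_ident])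
  moreover have "(hom_ext \<gamma> has_derivative (\<lambda>h. h \<bullet> xi \<gamma> n)) (at (1 *\<^sub>R n))"
    using GDERIV_xi[OF assms] by (simp add: gderiv_def)
  ultimately have "((\<lambda>t. hom_ext \<gamma> (t *\<^sub>R n)) has_derivative (\<lambda>t. (t *\<^sub>R n) \<bullet> xi \<gamma> n)) (at 1)"
    by (rule has_derivative_compose)
  then have "((\<lambda>t. hom_ext \<gamma> (t *\<^sub>R n)) has_real_derivative (n \<bullet> xi \<gamma> n)) (at 1)"
    by (rule has_derivative_imp_has_field_derivative) simp
  then have "((\<lambda>t. t * \<gamma> n) has_real_derivative (n \<bullet> xi \<gamma> n)) (at 1)"
  \<comment> \<open>Homogeneity is available for positive factors, so the ray is restricted to the
    open half-line, which contains 1.\<close>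
  proof (rule has_field_derivative_transform_within_open)
    show "open {0::real<..}" by simp
    show "hom_ext \<gamma> (t *\<^sub>R n) = t * \<gamma> n" if "t \<in> {0<..}" for t
      using that assms(2) by (simp add: hom_ext_scaleR hom_ext_sphere)
  qed simp
  moreover have "((\<lambda>t. t * \<gamma> n) has_real_derivative \<gamma> n) (at 1)"
    by (auto intro!: derivative_eq_intros)
  ultimately show ?thesis by (rule DERIV_unique)
qed

text \<open>The constant bounds \<open>xi \<gamma>\<close> on the circle, by compactness. The mean
  value inequality then covers segments avoiding the origin. On a segment through the origin the
  norms of the end points add up to its length, so linear growth suffices.\<close>

lemma hom_ext_Lipschitz:
  assumes "surface_energy \<gamma>"
  obtains C where "0 \<le> C" "\<And>p q. \<bar>hom_ext \<gamma> p - hom_ext \<gamma> q\<bar> \<le> C * norm (p - q)"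
proof -
  have "compact (xi \<gamma> ` sphere 0 1)"
    using assms by (intro compact_continuous_image) (auto simp: surface_energy_def)
  then obtain C where C: "\<And>n. norm n = 1 \<Longrightarrow> norm (xi \<gamma> n) \<le> C"
    by (metis bounded_iff compact_imp_bounded imageI mem_sphere_0)
  have "0 \<le> C" using C[of "axis 1 1"] norm_ge_zero order_trans by (metis norm_axis_1)
  \<comment> \<open>By Euler's relation the same constant bounds \<gamma> on the circle.\<close>
  have bound: "\<bar>hom_ext \<gamma> p\<bar> \<le> C * norm p" for p
  proof (cases "p = 0")
    case False
    let ?n = "p /\<^sub>R norm p"
    have n: "norm ?n = 1" using False by simp
    have "\<bar>\<gamma> ?n\<bar> \<le> norm ?n * norm (xi \<gamma> ?n)"
      using Cauchy_Schwarz_ineq2[of ?n "xi \<gamma> ?n"] inner_xi_self[OF assms n] by simp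
    also have "\<dots> \<le> C" using C[OF n] n by simp
    finally show ?thesis using False
      by (simp add: hom_ext_def abs_mult mult.commute[of C] mult_left_mono)
  qed (simp add: hom_ext_def)
  have "\<bar>hom_ext \<gamma> p - hom_ext \<gamma> q\<bar> \<le> C * norm (p - q)" for p q
  proof (cases "0 \<in> closed_segment p q")
    case True
    then have "norm (p - q) = norm p + norm q"
      using between_mem_segment[of p q 0] between[of p q 0] by (simp add: dist_norm)
    then show ?thesis using bound[of p] bound[of q] by (simp add: distrib_left)
  next
    case False
    let ?D = "\<lambda>x h. h \<bullet> xi \<gamma> (x /\<^sub>R norm x)"
    have "norm (hom_ext \<gamma> p - hom_ext \<gamma> q) \<le> C * norm (p - q)"
    proof (rule differentiable_bound)
      fix x assume "x \<in> closed_segment p q"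
      then have "x \<noteq> 0" using False by blast
      then show "(hom_ext \<gamma> has_derivative ?D x) (at x within closed_segment p q)"
        using GDERIV_hom_ext[OF assms] has_derivative_at_withinI unfolding gderiv_def by blast
      show "onorm (?D x) \<le> C"
      proof (rule onorm_bound[OF \<open>0 \<le> C\<close>])
        fix h :: "real^2"
        have "norm (?D x h) \<le> norm h * norm (xi \<gamma> (x /\<^sub>R norm x))"
          using Cauchy_Schwarz_ineq2 by simp
        also have "\<dots> \<le> norm h * C" using \<open>x \<noteq> 0\<close> by (intro mult_left_mono C) auto
        finally show "norm (?D x h) \<le> C * norm h" by (simp add: mult.commute)
      qed
    qed auto
    then show ?thesis by simp
  qed
  with \<open>0 \<le> C\<close> show ?thesis by (rule that)
qed

section \<open>The matrix \<open>Z_mat\<close> applied to the tangent\<close>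

lemma outer_prod_mult_vec: "outer_prod u v *v x = (v \<bullet> x) *\<^sub>R u"
  by (simp add: vec_eq_iff forall_2 outer_prod_def matrix_vector_mult_def matrix_matrix_mult_def
      columnvector_def rowvector_def inner_vec_def sum_2 algebra_simps)

lemma Z_mat_mult_vec:
  "Z_mat \<gamma> k n *v x = \<gamma> n *\<^sub>R x - (xi \<gamma> n \<bullet> x) *\<^sub>R n - (n \<bullet> x) *\<^sub>R xi \<gamma> n + (k n * (n \<bullet> x)) *\<^sub>R n"
  by (simp add: Z_mat_def matrix_vector_mult_add_rdistrib matrix_vector_mult_diff_rdistrib
      scaleR_matrix_vector_assoc[symmetric] outer_prod_mult_vec)

text \<open>
  Hence the weak formulation tests against the derivative of the energy density, whatever \<open>k\<close>:
  \<open>Z\<^sub>k(n)\<tau>\<close> is \<open>\<xi>(n)\<close> rotated back by the rotation taking \<open>\<tau>\<close> to \<open>n\<close>.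
\<close>

lemma Z_mat_tangent_inner:
  assumes "surface_energy \<gamma>" "norm \<tau> = 1"
  shows "(Z_mat \<gamma> k (- perp \<tau>) *v \<tau>) \<bullet> w = (- perp w) \<bullet> xi \<gamma> (- perp \<tau>)"
proof -
  define n where "n = - perp \<tau>"
  have n: "n $ 1 = - \<tau> $ 2" "n $ 2 = \<tau> $ 1" by (simp_all add: n_def)
  have "\<tau> \<bullet> \<tau> = 1" using assms(2) by (simp add: norm_eq_1)
  then have 1: "\<tau> $ 1 * \<tau> $ 1 = 1 - \<tau> $ 2 * \<tau> $ 2" by (simp add: inner_vec_def sum_2)
  have "n \<bullet> xi \<gamma> n = \<gamma> n" using assms by (intro inner_xi_self) (simp_all add: n_def)
  then have \<gamma>: "\<gamma> n = \<tau> $ 1 * xi \<gamma> n $ 2 - \<tau> $ 2 * xi \<gamma> n $ 1"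
    by (simp add: inner_vec_def sum_2 n)
  \<comment> \<open>Keeping the squared length of \<tau> as a factor makes this a polynomial
    identity; that it equals 1 enters only afterwards.\<close>
  have "(Z_mat \<gamma> k n *v \<tau>) \<bullet> w
      = (\<tau> $ 1 * \<tau> $ 1 + \<tau> $ 2 * \<tau> $ 2) * ((- perp w) \<bullet> xi \<gamma> n)"
    unfolding Z_mat_mult_vec \<gamma> by (simp add: inner_vec_def sum_2 n) (simp add: algebra_simps)
  then show ?thesis using 1 by (simp add: n_def)
qed

section \<open>Differentiation of integral functionals\<close>

text \<open>A Lipschitz density has linear growth, hence is integrable along L2 functions, and on a
  circle of length 1 the L1 distance is at most the L2 distance.\<close>

lemma integral_functional_Lipschitz:
  fixes \<Phi> :: "'a::euclidean_space \<Rightarrow> real"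
  assumes lip: "\<And>p q. \<bar>\<Phi> p - \<Phi> q\<bar> \<le> C * norm (p - q)" and "0 \<le> C"
    and p: "p \<in> L2 1" and q: "q \<in> L2 1"
  shows "integrable (torus 1) (\<lambda>x. \<Phi> (p x))"
    and "\<bar>(LINT x|torus 1. \<Phi> (p x)) - (LINT x|torus 1. \<Phi> (q x))\<bar> \<le> C * L2_norm 1 (\<lambda>x. p x - q x)"
proof -
  have "C-lipschitz_on UNIV \<Phi>"
    using lip \<open>0 \<le> C\<close> by (intro lipschitz_onI) (auto simp: dist_norm)
  then have "continuous_on UNIV \<Phi>" by (rule lipschitz_on_continuous_on)
  then have [measurable]: "\<Phi> \<in> borel_measurable borel"
    by (rule borel_measurable_continuous_onI)
  have int: "integrable (torus 1) (\<lambda>x. \<Phi> (r x))" if r: "r \<in> L2 1" for r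
  proof (rule Bochner_Integration.integrable_bound)
    note [measurable] = L2_D(1)[OF r]
    show "integrable (torus 1) (\<lambda>x. \<bar>\<Phi> 0\<bar> + C * norm (r x))"
      using L2_integrable[OF L2_norm_fun[OF r]] by simp
    show "(\<lambda>x. \<Phi> (r x)) \<in> borel_measurable (torus 1)" by measurable
    have "\<bar>\<Phi> (r x)\<bar> \<le> \<bar>\<bar>\<Phi> 0\<bar> + C * norm (r x)\<bar>" for x
      using lip[of "r x" 0] by simp
    then show "AE x in torus 1. norm (\<Phi> (r x)) \<le> norm (\<bar>\<Phi> 0\<bar> + C * norm (r x))" by simp
  qed
  show "integrable (torus 1) (\<lambda>x. \<Phi> (p x))" by (rule int[OF p])
  have "\<bar>(LINT x|torus 1. \<Phi> (p x)) - (LINT x|torus 1. \<Phi> (q x))\<bar> = \<bar>LINT x|torus 1. \<Phi> (p x) - \<Phi> (q x)\<bar>"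
    using int[OF p] int[OF q] by simp
  also have "\<dots> \<le> (LINT x|torus 1. C * norm (p x - q x))"
    using L2_integrable[OF L2_norm_fun[OF L2_diff[OF p q]]] lip int[OF p] int[OF q]
    by (intro integral_abs_bound_integral) auto
  also have "\<dots> \<le> C * L2_norm 1 (\<lambda>x. p x - q x)"
    using L1_le_L2_norm[OF L2_diff[OF p q]] \<open>0 \<le> C\<close> by (simp add: mult_left_mono)
  finally show "\<bar>(LINT x|torus 1. \<Phi> (p x)) - (LINT x|torus 1. \<Phi> (q x))\<bar>
      \<le> C * L2_norm 1 (\<lambda>x. p x - q x)" .
qed

text \<open>
  The functional need not be differentiable in \<open>L\<^sup>2\<close>: the Lipschitz bound allows to replace the curve
  \<open>p\<close> by its tangent line, along which dominated convergence applies.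
\<close>

lemma integral_functional_derivative:
  fixes \<Phi> :: "'a::euclidean_space \<Rightarrow> real"
  assumes lip: "\<And>p q. \<bar>\<Phi> p - \<Phi> q\<bar> \<le> C * norm (p - q)" and "0 \<le> C"
    and der: "\<And>q. q \<noteq> 0 \<Longrightarrow> (\<Phi> has_derivative \<Phi>' q) (at q)"
    and p0: "p0 \<in> L2 1" "AE x in torus 1. p0 x \<noteq> 0" and w: "w \<in> L2 1"
    and meas: "(\<lambda>x. if p0 x = 0 then 0 else \<Phi>' (p0 x) (w x)) \<in> borel_measurable (torus 1)"
    and p: "\<forall>\<^sub>F h in at 0. p h \<in> L2 1"
    and lim: "((\<lambda>h. L2_norm 1 (\<lambda>x. (p h x - p0 x) /\<^sub>R h - w x)) \<longlongrightarrow> 0) (at 0)"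
  shows "((\<lambda>h. ((LINT x|torus 1. \<Phi> (p h x)) - (LINT x|torus 1. \<Phi> (p0 x))) / h) \<longlongrightarrow>
      (LINT x|torus 1. (if p0 x = 0 then 0 else \<Phi>' (p0 x) (w x)))) (at 0)"
proof -
  define E where "E q = (LINT x|torus 1. \<Phi> (q x))" for q
  define l where "l h x = p0 x + h *\<^sub>R w x" for h x
  \<comment> \<open>The default 0 is taken where \<open>\<Phi>\<close> may fail to be
    differentiable, a null set by the assumption on \<open>p0\<close>.\<close>
  let ?G = "\<lambda>x. if p0 x = 0 then 0 else \<Phi>' (p0 x) (w x)"
  note F = integral_functional_Lipschitz[OF lip \<open>0 \<le> C\<close>]
  have l: "l h \<in> L2 1" for h unfolding l_def by (intro L2_add L2_scaleR p0 w)
  have "((\<lambda>h. (E (l h) - E p0) / h) \<longlongrightarrow> (LINT x|torus 1. ?G x)) (at 0)"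
    \<comment> \<open>Dominated convergence is a statement about sequences.\<close>
    unfolding tendsto_at_iff_sequentially
  proof (intro allI impI)
    fix r :: "nat \<Rightarrow> real" assume r: "\<forall>i. r i \<in> UNIV - {0}" "r \<longlonglongrightarrow> 0"
    have "(\<lambda>n. LINT x|torus 1. (\<Phi> (l (r n) x) - \<Phi> (p0 x)) / r n) \<longlonglongrightarrow> (LINT x|torus 1. ?G x)"
    proof (rule integral_dominated_convergence[OF meas])
      show "(\<lambda>x. (\<Phi> (l (r n) x) - \<Phi> (p0 x)) / r n) \<in> borel_measurable (torus 1)" for n
        using F(1)[OF l l] F(1)[OF p0(1) p0(1)] by (intro borel_measurable_integrable) auto
      show "integrable (torus 1) (\<lambda>x. C * norm (w x))"
        using L2_integrable[OF L2_norm_fun[OF w]] by simp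
      have "\<bar>(\<Phi> (l (r n) x) - \<Phi> (p0 x)) / r n\<bar> \<le> C * norm (w x)" for n x
        using lip[of "l (r n) x" "p0 x"] r(1) by (simp add: l_def divide_le_eq mult_ac)
      then show "AE x in torus 1. norm ((\<Phi> (l (r n) x) - \<Phi> (p0 x)) / r n) \<le> C * norm (w x)" for n
        by simp
      show "AE x in torus 1. (\<lambda>n. (\<Phi> (l (r n) x) - \<Phi> (p0 x)) / r n) \<longlonglongrightarrow> ?G x"
        using p0(2)
      proof eventually_elim
        case (elim x)
        have "((\<lambda>h. p0 x + h *\<^sub>R w x) has_derivative (\<lambda>h. h *\<^sub>R w x)) (at 0)"
          using has_derivative_add[OF has_derivative_const bounded_linear.has_derivative[OF
              bounded_linear_scaleR_left[of "w x"] has_derivative_ident], of "p0 x" "at 0"] by simp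
        moreover have "(\<Phi> has_derivative \<Phi>' (p0 x)) (at (p0 x + 0 *\<^sub>R w x))"
          using der[OF elim] by simp
        ultimately have "((\<lambda>h. \<Phi> (p0 x + h *\<^sub>R w x)) has_derivative (\<lambda>h. \<Phi>' (p0 x) (h *\<^sub>R w x))) (at 0)"
          by (rule has_derivative_compose)
        moreover have "\<Phi>' (p0 x) (h *\<^sub>R w x) = \<Phi>' (p0 x) (w x) * h" for h
          using linear_scale[OF has_derivative_linear[OF der[OF elim]]] by (simp add: mult.commute)
        ultimately have "((\<lambda>h. \<Phi> (p0 x + h *\<^sub>R w x)) has_real_derivative \<Phi>' (p0 x) (w x)) (at 0)"
          by (simp add: has_field_derivative_def)
        then have "((\<lambda>h. (\<Phi> (l h x) - \<Phi> (p0 x)) / h) \<longlongrightarrow> \<Phi>' (p0 x) (w x)) (at 0)"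
          by (simp add: DERIV_def l_def)
        moreover have "filterlim r (at 0) sequentially"
          using r by (auto simp: filterlim_at)
        ultimately show ?case
          using elim by (auto intro: filterlim_compose)
      qed
    qed
    moreover have "(\<lambda>n. LINT x|torus 1. (\<Phi> (l (r n) x) - \<Phi> (p0 x)) / r n)
        = (\<lambda>n. (E (l (r n)) - E p0) / r n)"
      using F(1)[OF l l] F(1)[OF p0(1) p0(1)] by (simp add: E_def)
    ultimately show "((\<lambda>h. (E (l h) - E p0) / h) \<circ> r) \<longlonglongrightarrow> (LINT x|torus 1. ?G x)"
      by (simp only: o_def)
  qed
  \<comment> \<open>The Lipschitz bound makes the error at most \<open>C * \<bar>h\<bar>\<close>
    times the distance of the difference quotient from \<open>w\<close>; division by
    \<open>h\<close> leaves a null function of \<open>h\<close>.\<close>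
  moreover have "((\<lambda>h. (E (p h) - E (l h)) / h) \<longlongrightarrow> 0) (at 0)"
  proof (rule Lim_null_comparison)
    show "\<forall>\<^sub>F h in at 0. norm ((E (p h) - E (l h)) / h)
        \<le> C * L2_norm 1 (\<lambda>x. (p h x - p0 x) /\<^sub>R h - w x)"
      using p eventually_neq_at_within[of "0::real" 0 UNIV]
    proof eventually_elim
      case (elim h)
      have "\<bar>E (p h) - E (l h)\<bar> \<le> C * L2_norm 1 (\<lambda>x. p h x - l h x)"
        unfolding E_def by (rule F(2)[OF elim(1) l])
      also have "(\<lambda>x. p h x - l h x) = (\<lambda>x. h *\<^sub>R ((p h x - p0 x) /\<^sub>R h - w x))"
        using elim(2) by (simp add: l_def algebra_simps)
      finally show ?case
        using elim(2) by (simp only: L2_norm_scaleR) (simp add: divide_le_eq mult_ac)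
    qed
    show "((\<lambda>h. C * L2_norm 1 (\<lambda>x. (p h x - p0 x) /\<^sub>R h - w x)) \<longlongrightarrow> 0) (at 0)"
      by (rule tendsto_mult_right_zero[OF lim])
  qed
  ultimately have "((\<lambda>h. (E (l h) - E p0) / h + (E (p h) - E (l h)) / h) \<longlongrightarrow>
      (LINT x|torus 1. ?G x) + 0) (at 0)"
    by (rule tendsto_add)
  then show ?thesis by (simp add: E_def add_divide_distrib[symmetric])
qed

section \<open>Area and energy of closed curves\<close>

lemma inner_axis_1: "x \<bullet> axis i (1::real) = x $ i"
  by (simp add: inner_axis)

lemma L2_nth:
  fixes u :: "real \<Rightarrow> real^'n"
  shows "u \<in> L2 L \<Longrightarrow> (\<lambda>x. u x $ i) \<in> L2 L"
  using L2_inner_const[of u L "axis i 1"] by (simp add: inner_axis_1)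

lemma is_weak_deriv_nth:
  fixes u v :: "real \<Rightarrow> real^'n"
  shows "is_weak_deriv L u v \<Longrightarrow> u \<in> L2 L \<Longrightarrow> v \<in> L2 L \<Longrightarrow> is_weak_deriv L (\<lambda>x. u x $ i) (\<lambda>x. v x $ i)"
  using is_weak_deriv_inner[of L u v "axis i 1"] by (simp add: inner_axis_1)

lemma H1_nth:
  fixes u :: "real \<Rightarrow> real^'n"
  shows "u \<in> H1 L \<Longrightarrow> (\<lambda>x. u x $ i) \<in> H1 L"
  using wderiv_H1[of u L] by (intro H1_I[OF L2_nth L2_nth is_weak_deriv_nth])

lemma wderiv_nth:
  fixes u :: "real \<Rightarrow> real^'n"
  shows "u \<in> H1 1 \<Longrightarrow> AE x in torus 1. wderiv 1 (\<lambda>x. u x $ i) x = wderiv 1 u x $ i"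
  using wderiv_inner[of u "axis i 1"] by (simp add: inner_axis_1)

lemma L2_norm_nth_le:
  fixes u :: "real \<Rightarrow> real^'n"
  assumes "u \<in> L2 L"
  shows "L2_norm L (\<lambda>x. u x $ i) \<le> L2_norm L u"
  unfolding L2_norm_def using component_le_norm_cart[of "u _" i]
  by (intro real_sqrt_le_mono integral_mono L2_D(2) L2_nth assms)
     (simp add: abs_le_square_iff[symmetric])

lemma tendsto_L2_norm_nth:
  fixes u :: "'b \<Rightarrow> real \<Rightarrow> real^'n"
  assumes "\<forall>\<^sub>F i in F. u i \<in> L2 L" "u' \<in> L2 L" "((\<lambda>i. L2_norm L (\<lambda>x. u i x - u' x)) \<longlongrightarrow> 0) F"
  shows "((\<lambda>i. L2_norm L (\<lambda>x. u i x $ j - u' x $ j)) \<longlongrightarrow> 0) F"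
proof (rule Lim_null_comparison[OF _ assms(3)])
  show "\<forall>\<^sub>F i in F. norm (L2_norm L (\<lambda>x. u i x $ j - u' x $ j)) \<le> L2_norm L (\<lambda>x. u i x - u' x)"
    using assms(1)
  proof eventually_elim
    case (elim i)
    show ?case using L2_norm_nth_le[OF L2_diff[OF elim assms(2)], of j] by simp
  qed
qed

text \<open>\<open>H1_norm\<close> contains the weak derivative chosen for the whole quotient, and
  this choice is linear almost everywhere. Convergence of difference quotients in H1 thus yields L2
  convergence of those of \<open>wderiv 1 (X t)\<close>.\<close>

lemma wderiv_diff_quotient_le:
  assumes "u \<in> H1 1" "v \<in> H1 1" "w \<in> H1 1"
  shows "L2_norm 1 (\<lambda>x. (wderiv 1 u x - wderiv 1 v x) /\<^sub>R h - wderiv 1 w x)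
    \<le> H1_norm 1 (\<lambda>x. (u x - v x) /\<^sub>R h - w x)"
proof -
  let ?q = "\<lambda>x. (u x - v x) /\<^sub>R h" and ?s = "\<lambda>x. (wderiv 1 u x - wderiv 1 v x) /\<^sub>R h - wderiv 1 w x"
  have q: "?q \<in> H1 1" using assms by (intro H1_scaleR H1_diff)
  have "AE x in torus 1. wderiv 1 (\<lambda>x. ?q x - w x) x = ?s x"
    using wderiv_diff[OF q assms(3)] wderiv_scaleR[OF H1_diff[OF assms(1,2)], of "inverse h"]
      wderiv_diff[OF assms(1,2)]
    by eventually_elim simp
  moreover have "wderiv 1 (\<lambda>x. ?q x - w x) \<in> L2 1" using q assms(3) by (intro wderiv_H1 H1_diff)
  moreover have "?s \<in> L2 1" using assms by (intro L2_diff L2_scaleR wderiv_H1)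
  ultimately have "L2_norm 1 ?s = L2_norm 1 (wderiv 1 (\<lambda>x. ?q x - w x))"
    by (intro L2_norm_cong_AE[symmetric] L2_D)
  then show ?thesis using L2_norm_le_H1_norm(2) by simp
qed

lemma wderiv_diff_le:
  assumes "u \<in> H1 1" "v \<in> H1 1"
  shows "L2_norm 1 (\<lambda>x. wderiv 1 u x - wderiv 1 v x) \<le> H1_norm 1 (\<lambda>x. u x - v x)"
proof -
  have "AE x in torus 1. wderiv 1 (\<lambda>x. u x - v x) x = wderiv 1 u x - wderiv 1 v x"
    by (rule wderiv_diff[OF assms])
  then have "L2_norm 1 (\<lambda>x. wderiv 1 u x - wderiv 1 v x) = L2_norm 1 (wderiv 1 (\<lambda>x. u x - v x))"
    using assms by (intro L2_norm_cong_AE[symmetric] L2_D L2_diff wderiv_H1 H1_diff)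
  then show ?thesis using L2_norm_le_H1_norm(2) by simp
qed

lemma wderiv_torus_scale:
  assumes "0 < L" "u \<in> H1 L" "v \<in> L2 1" "AE x in torus 1. v x = u (L * x)"
  shows "AE x in torus 1. wderiv 1 v x = L *\<^sub>R wderiv L u (L * x)"
proof -
  note w = wderiv_H1[OF assms(2)]
  have uL: "(\<lambda>x. u (L * x)) \<in> L2 1" by (rule L2_torus_scale[OF assms(1) w(1)])
  have "is_weak_deriv 1 v (\<lambda>x. L *\<^sub>R wderiv L u (L * x))"
    using assms(3,4) uL
    by (intro is_weak_deriv_cong_AE[OF is_weak_deriv_torus_scale[OF assms(1) w] ] L2_D) auto
  then show ?thesis
    using assms(1,3) w(2) by (intro wderiv_AE_eq L2_scaleR L2_torus_scale)
qed

text \<open>This is completeness of Lebesgue measure.\<close>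

lemma borel_measurable_torus_AE:
  fixes f g :: "real \<Rightarrow> 'a::euclidean_space"
  assumes "f \<in> borel_measurable (torus L)" "AE x in torus L. f x = g x"
  shows "g \<in> borel_measurable (torus L)"
proof -
  have "(\<lambda>x. indicat_real {0..L} x *\<^sub>R f x) \<in> borel_measurable lebesgue"
    using assms(1) borel_measurable_restrict_space_iff[of "{0..L}" lebesgue f] by (simp add: torus_def)
  moreover have "AE x in lebesgue. indicat_real {0..L} x *\<^sub>R f x = indicat_real {0..L} x *\<^sub>R g x"
  proof -
    have "AE x in lebesgue. x \<in> {0..L} \<longrightarrow> f x = g x"
      using assms(2) unfolding torus_def by (subst (asm) AE_restrict_space_iff) auto
    then show ?thesis by eventually_elim (auto simp: indicator_def)
  qed
  ultimately have "(\<lambda>x. indicat_real {0..L} x *\<^sub>R g x) \<in> borel_measurable lebesgue"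
    by (rule borel_measurable_AE)
  then show ?thesis
    using borel_measurable_restrict_space_iff[of "{0..L}" lebesgue g] by (simp add: torus_def)
qed

lemma area_eq:
  assumes "closed_curve Y"
  shows "area Y = (LINT \<rho>|torus 1. Y \<rho> $ 2 * wderiv 1 Y \<rho> $ 1)"
  unfolding area_def curve_integral_def
proof (rule integral_cong_AE)
  have Y: "Y \<in> H1 1" and pos: "AE \<rho> in torus 1. 0 < ds_drho Y \<rho>"
    using assms by (auto simp: closed_curve_def)
  note [measurable] = L2_D(1)[OF wderiv_H1(2)[OF Y]] L2_D(1)[OF L2_nth[OF wderiv_H1(2)[OF Y]]]
    L2_D(1)[OF L2_nth[OF wderiv_H1(1)[OF Y]]] L2_D(1)[OF wderiv_H1(2)[OF H1_nth[OF Y]]]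
  show "(\<lambda>\<rho>. Y \<rho> $ 2 * arc_deriv Y (\<lambda>q. Y q $ 1) \<rho> * ds_drho Y \<rho>) \<in> borel_measurable (torus 1)"
    unfolding arc_deriv_def ds_drho_def by measurable
  show "(\<lambda>\<rho>. Y \<rho> $ 2 * wderiv 1 Y \<rho> $ 1) \<in> borel_measurable (torus 1)"
    by measurable
  show "AE \<rho> in torus 1. Y \<rho> $ 2 * arc_deriv Y (\<lambda>q. Y q $ 1) \<rho> * ds_drho Y \<rho> = Y \<rho> $ 2 * wderiv 1 Y \<rho> $ 1"
    using pos wderiv_nth[OF Y, of 1] by eventually_elim (simp add: arc_deriv_def)
qed

lemma normal_eq: "normal Y \<rho> = (- perp (wderiv 1 Y \<rho>)) /\<^sub>R norm (wderiv 1 Y \<rho>)"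
  by (simp add: normal_def tangent_def arc_deriv_def ds_drho_def perp_scaleR)

text \<open>Homogeneity absorbs the speed into the density. The identity is pointwise: where the
  derivative is 0, both integrands vanish.\<close>

lemma energy_eq: "energy \<gamma> Y = (LINT \<rho>|torus 1. hom_ext \<gamma> (- perp (wderiv 1 Y \<rho>)))"
  unfolding energy_def curve_integral_def
  by (intro Bochner_Integration.integral_cong) (auto simp: normal_eq hom_ext_def ds_drho_def)

text \<open>The rotation is an isometry, so the constant of \<open>hom_ext \<gamma>\<close> carries
  over.\<close>

lemma energy_density_Lipschitz:
  assumes "surface_energy \<gamma>"
  obtains C where "0 \<le> C"
    "\<And>p q. \<bar>hom_ext \<gamma> (- perp p) - hom_ext \<gamma> (- perp q)\<bar> \<le> C * norm (p - q)"
proof -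
  obtain C where C: "0 \<le> C" "\<And>p q. \<bar>hom_ext \<gamma> p - hom_ext \<gamma> q\<bar> \<le> C * norm (p - q)"
    using hom_ext_Lipschitz[OF assms] by blast
  have "norm (- perp p - - perp q) = norm (p - q)" for p q
    by (metis norm_perp perp_diff minus_diff_minus norm_minus_cancel)
  with C(2)[of "- perp _" "- perp _"] show ?thesis
    using C(1) by (intro that[of C]) (metis (no_types))+
qed

lemma energy_density_has_derivative:
  assumes "surface_energy \<gamma>" "q \<noteq> 0"
  shows "((\<lambda>q. hom_ext \<gamma> (- perp q)) has_derivative
      (\<lambda>w. (- perp w) \<bullet> xi \<gamma> ((- perp q) /\<^sub>R norm q))) (at q)"
proof -
  have "((\<lambda>q. - perp q) has_derivative (\<lambda>w. - perp w)) (at q)"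
    by (intro has_derivative_minus bounded_linear_imp_has_derivative bounded_linear_perp)
  moreover have "(hom_ext \<gamma> has_derivative (\<lambda>h. h \<bullet> xi \<gamma> ((- perp q) /\<^sub>R norm q))) (at (- perp q))"
    using GDERIV_hom_ext[OF assms(1), of "- perp q"] assms(2) by (simp add: gderiv_def)
  ultimately show ?thesis by (rule has_derivative_compose)
qed

text \<open>Continuity of \<open>xi \<gamma>\<close> is known on the circle, and normalization maps
  the complement of the origin there continuously. Setting the value 0 at the origin keeps the
  factor Borel.\<close>

lemma borel_measurable_energy_density_deriv:
  assumes "surface_energy \<gamma>" "p \<in> borel_measurable M" "w \<in> borel_measurable M"
  shows "(\<lambda>x. if p x = 0 then 0 else (- perp (w x)) \<bullet> xi \<gamma> ((- perp (p x)) /\<^sub>R norm (p x)))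
    \<in> borel_measurable M"
proof -
  let ?g = "\<lambda>q. if q \<in> {0} then 0 else xi \<gamma> ((- perp q) /\<^sub>R norm q)"
  have perp: "continuous_on S perp" for S
    by (intro linear_continuous_on bounded_linear_perp)
  have "?g \<in> borel_measurable borel"
  proof (rule borel_measurable_continuous_on_if)
    show "continuous_on (- {0}) (\<lambda>q. xi \<gamma> ((- perp q) /\<^sub>R norm q))"
    proof (rule continuous_on_compose2[of "sphere 0 1" "xi \<gamma>"])
      show "continuous_on (sphere 0 1) (xi \<gamma>)" using assms(1) by (simp add: surface_energy_def)
      show "continuous_on (- {0}) (\<lambda>q. (- perp q) /\<^sub>R norm q)"
        by (intro continuous_intros perp) auto
      show "(\<lambda>q. (- perp q) /\<^sub>R norm q) ` (- {0}) \<subseteq> sphere 0 1"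
        by (intro image_subsetI) simp
    qed
  qed auto
  then have "(\<lambda>x. ?g (p x)) \<in> borel_measurable M"
    using assms(2) by (rule measurable_compose[rotated])
  moreover have "(\<lambda>x. - perp (w x)) \<in> borel_measurable M"
    using borel_measurable_continuous_onI[OF perp] assms(3)
    by (intro borel_measurable_uminus) (rule measurable_compose)
  ultimately have "(\<lambda>x. (- perp (w x)) \<bullet> ?g (p x)) \<in> borel_measurable M"
    by (intro borel_measurable_inner)
  also have "(\<lambda>x. (- perp (w x)) \<bullet> ?g (p x))
      = (\<lambda>x. if p x = 0 then 0 else (- perp (w x)) \<bullet> xi \<gamma> ((- perp (p x)) /\<^sub>R norm (p x)))"
    by auto
  finally show ?thesis .
qed

text \<open>Two arclength derivatives contribute the inverse speed twice and \<open>ds\<close> the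
  speed once; the remaining inverse normalizes the tangent. Where the speed is 0 the left integrand
  vanishes, which agrees with the default value on the right.\<close>

lemma curve_inner_Z_mat:
  assumes "surface_energy \<gamma>"
  shows "curve_inner Y (\<lambda>\<rho>. Z_mat \<gamma> k (normal Y \<rho>) *v arc_deriv Y Y \<rho>) (arc_deriv Y V)
    = (LINT \<rho>|torus 1. (if wderiv 1 Y \<rho> = 0 then 0
        else (- perp (wderiv 1 V \<rho>)) \<bullet> xi \<gamma> ((- perp (wderiv 1 Y \<rho>)) /\<^sub>R norm (wderiv 1 Y \<rho>))))"
  unfolding curve_inner_def curve_integral_def
proof (intro Bochner_Integration.integral_cong refl)
  fix \<rho>
  let ?p = "wderiv 1 Y \<rho>"
  show "(Z_mat \<gamma> k (normal Y \<rho>) *v arc_deriv Y Y \<rho>) \<bullet> arc_deriv Y V \<rho> * ds_drho Y \<rho>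
    = (if ?p = 0 then 0 else (- perp (wderiv 1 V \<rho>)) \<bullet> xi \<gamma> ((- perp ?p) /\<^sub>R norm ?p))"
  proof (cases "?p = 0")
    case False
    have n: "normal Y \<rho> = - perp (?p /\<^sub>R norm ?p)"
      by (simp add: normal_eq perp_scaleR)
    have "(Z_mat \<gamma> k (normal Y \<rho>) *v (?p /\<^sub>R norm ?p)) \<bullet> wderiv 1 V \<rho>
        = (- perp (wderiv 1 V \<rho>)) \<bullet> xi \<gamma> (normal Y \<rho>)"
      unfolding n using False by (intro Z_mat_tangent_inner[OF assms]) simp
    then show ?thesis
      using False by (simp add: arc_deriv_def ds_drho_def) (simp add: normal_eq)
  qed (simp add: ds_drho_def)
qed

lemma eventually_shift_nonneg: "0 < t \<Longrightarrow> \<forall>\<^sub>F h in at (0::real). 0 \<le> t + h"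
  using eventually_at_in_open'[of "{- t<..}" 0] by (auto elim!: eventually_mono)

section \<open>Evolution of area and energy\<close>

context
  fixes \<gamma> k :: "real^2 \<Rightarrow> real" and X :: "real \<Rightarrow> real \<Rightarrow> real^2" and \<mu> :: "real \<Rightarrow> real \<Rightarrow> real"
  assumes sol: "variational_solution \<gamma> k X \<mu>"
begin

lemma solution_closed_curve: "0 \<le> t \<Longrightarrow> closed_curve (X t)"
  using sol by (simp add: variational_solution_def)

lemma solution_H1: "0 \<le> t \<Longrightarrow> X t \<in> H1 1"
  using solution_closed_curve by (simp add: closed_curve_def)

lemmas solution_L2 = wderiv_H1(1,2)[OF solution_H1]

lemma solution_nondegenerate: "0 \<le> t \<Longrightarrow> AE \<rho> in torus 1. wderiv 1 (X t) \<rho> \<noteq> 0"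
  using solution_closed_curve by (simp add: closed_curve_def ds_drho_def)

lemma solution_time_deriv: "0 < t \<Longrightarrow> has_time_deriv X t (time_deriv X t)"
  using sol unfolding variational_solution_def time_deriv_def by (metis someI_ex)

lemma time_deriv_H1: "0 < t \<Longrightarrow> time_deriv X t \<in> H1 1"
  using solution_time_deriv by (simp add: has_time_deriv_def)

lemma solution_continuous:
  assumes "0 \<le> t"
  shows "((\<lambda>r. L2_norm 1 (\<lambda>\<rho>. X r \<rho> - X t \<rho>)) \<longlongrightarrow> 0) (at t within {0..})"
    and "((\<lambda>r. L2_norm 1 (\<lambda>\<rho>. wderiv 1 (X r) \<rho> - wderiv 1 (X t) \<rho>)) \<longlongrightarrow> 0) (at t within {0..})"
proof -
  have lim: "((\<lambda>r. H1_norm 1 (\<lambda>\<rho>. X r \<rho> - X t \<rho>)) \<longlongrightarrow> 0) (at t within {0..})"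
    using sol assms by (simp add: variational_solution_def)
  show "((\<lambda>r. L2_norm 1 (\<lambda>\<rho>. X r \<rho> - X t \<rho>)) \<longlongrightarrow> 0) (at t within {0..})"
    by (intro Lim_null_comparison[OF _ lim] always_eventually) (simp add: L2_norm_le_H1_norm(1))
  have "\<forall>\<^sub>F r in at t within {0..}. norm (L2_norm 1 (\<lambda>\<rho>. wderiv 1 (X r) \<rho> - wderiv 1 (X t) \<rho>))
      \<le> H1_norm 1 (\<lambda>\<rho>. X r \<rho> - X t \<rho>)"
    unfolding eventually_at_filter
    using wderiv_diff_le[OF solution_H1 solution_H1[OF assms]] by (intro always_eventually) auto
  then show "((\<lambda>r. L2_norm 1 (\<lambda>\<rho>. wderiv 1 (X r) \<rho> - wderiv 1 (X t) \<rho>)) \<longlongrightarrow> 0) (at t within {0..})"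
    using lim by (rule Lim_null_comparison)
qed

lemma solution_diff_quotient:
  assumes "0 < t"
  shows "((\<lambda>h. L2_norm 1 (\<lambda>\<rho>. (X (t + h) \<rho> - X t \<rho>) /\<^sub>R h - time_deriv X t \<rho>)) \<longlongrightarrow> 0) (at 0)"
    and "((\<lambda>h. L2_norm 1 (\<lambda>\<rho>. (wderiv 1 (X (t + h)) \<rho> - wderiv 1 (X t) \<rho>) /\<^sub>R h
            - wderiv 1 (time_deriv X t) \<rho>)) \<longlongrightarrow> 0) (at 0)"
proof -
  let ?V = "time_deriv X t"
  have lim: "((\<lambda>h. H1_norm 1 (\<lambda>\<rho>. (X (t + h) \<rho> - X t \<rho>) /\<^sub>R h - ?V \<rho>)) \<longlongrightarrow> 0) (at 0)"
    using solution_time_deriv[OF assms] by (simp add: has_time_deriv_def)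
  show "((\<lambda>h. L2_norm 1 (\<lambda>\<rho>. (X (t + h) \<rho> - X t \<rho>) /\<^sub>R h - ?V \<rho>)) \<longlongrightarrow> 0) (at 0)"
    by (intro Lim_null_comparison[OF _ lim] always_eventually) (simp add: L2_norm_le_H1_norm(1))
  have "\<forall>\<^sub>F h in at 0. norm (L2_norm 1 (\<lambda>\<rho>. (wderiv 1 (X (t + h)) \<rho> - wderiv 1 (X t) \<rho>) /\<^sub>R h
      - wderiv 1 ?V \<rho>)) \<le> H1_norm 1 (\<lambda>\<rho>. (X (t + h) \<rho> - X t \<rho>) /\<^sub>R h - ?V \<rho>)"
    using eventually_shift_nonneg[OF assms]
  proof eventually_elim
    case (elim h)
    show ?case
      using wderiv_diff_quotient_le[OF solution_H1[OF elim] solution_H1 time_deriv_H1[OF assms], of t h]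
        assms by simp
  qed
  then show "((\<lambda>h. L2_norm 1 (\<lambda>\<rho>. (wderiv 1 (X (t + h)) \<rho> - wderiv 1 (X t) \<rho>) /\<^sub>R h
            - wderiv 1 ?V \<rho>)) \<longlongrightarrow> 0) (at 0)"
    using lim by (rule Lim_null_comparison)
qed

lemma solution_eq1:
  assumes "0 < t" "\<phi> \<in> H1 1"
  shows "curve_inner (X t) (\<lambda>\<rho>. normal (X t) \<rho> \<bullet> time_deriv X t \<rho>) \<phi>
        = - curve_inner (X t) (arc_deriv (X t) (\<mu> t)) (arc_deriv (X t) \<phi>)"
proof -
  have "curve_inner (X t) (\<lambda>\<rho>. normal (X t) \<rho> \<bullet> time_deriv X t \<rho>) \<phi>
      + curve_inner (X t) (arc_deriv (X t) (\<mu> t)) (arc_deriv (X t) \<phi>) = 0"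
    using sol assms unfolding variational_solution_def by blast
  then show ?thesis by linarith
qed

lemma solution_eq2:
  assumes "0 < t" "\<omega> \<in> H1 1"
  shows "curve_inner (X t) (\<lambda>\<rho>. Z_mat \<gamma> k (normal (X t) \<rho>) *v arc_deriv (X t) (X t) \<rho>)
          (arc_deriv (X t) \<omega>)
        = curve_inner (X t) (\<mu> t) (\<lambda>\<rho>. normal (X t) \<rho> \<bullet> \<omega> \<rho>)"
proof -
  have "curve_inner (X t) (\<mu> t) (\<lambda>\<rho>. normal (X t) \<rho> \<bullet> \<omega> \<rho>)
      - curve_inner (X t) (\<lambda>\<rho>. Z_mat \<gamma> k (normal (X t) \<rho>) *v arc_deriv (X t) (X t) \<rho>)
          (arc_deriv (X t) \<omega>) = 0"
    using sol assms unfolding variational_solution_def by blast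
  then show ?thesis by linarith
qed

lemma continuous_on_area: "continuous_on {0..} (\<lambda>t. area (X t))"
  unfolding continuous_on_def
proof
  fix t :: real assume "t \<in> {0..}"
  then have t: "0 \<le> t" by simp
  have ev: "\<forall>\<^sub>F r in at t within {0..}. 0 \<le> r"
    by (simp add: eventually_at_filter)
  have X: "\<forall>\<^sub>F r in at t within {0..}. X r \<in> L2 1" "\<forall>\<^sub>F r in at t within {0..}. wderiv 1 (X r) \<in> L2 1"
    using ev by (auto elim!: eventually_mono intro: solution_L2)
  have "((\<lambda>r. LINT \<rho>|torus 1. X r \<rho> $ 2 \<bullet> wderiv 1 (X r) \<rho> $ 1) \<longlongrightarrow>
      (LINT \<rho>|torus 1. X t \<rho> $ 2 \<bullet> wderiv 1 (X t) \<rho> $ 1)) (at t within {0..})"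
    by (intro tendsto_L2_inner L2_nth[OF solution_L2(1)] L2_nth[OF solution_L2(2)] t
        eventually_mono[OF X(1) L2_nth] eventually_mono[OF X(2) L2_nth]
        tendsto_L2_norm_nth[OF X(1) solution_L2(1)[OF t] solution_continuous(1)[OF t]]
        tendsto_L2_norm_nth[OF X(2) solution_L2(2)[OF t] solution_continuous(2)[OF t]])
  then have "((\<lambda>r. LINT \<rho>|torus 1. X r \<rho> $ 2 * wderiv 1 (X r) \<rho> $ 1) \<longlongrightarrow> area (X t)) (at t within {0..})"
    using area_eq[OF solution_closed_curve[OF t]] by simp
  moreover have "\<forall>\<^sub>F r in at t within {0..}. (LINT \<rho>|torus 1. X r \<rho> $ 2 * wderiv 1 (X r) \<rho> $ 1) = area (X r)"
    using ev by eventually_elim (simp add: area_eq[OF solution_closed_curve])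
  ultimately show "((\<lambda>r. area (X r)) \<longlongrightarrow> area (X t)) (at t within {0..})"
    by (rule Lim_transform_eventually)
qed

lemma area_has_derivative_0:
  assumes t: "0 < t"
  shows "((\<lambda>t. area (X t)) has_real_derivative 0) (at t)"
proof -
  let ?V = "time_deriv X t" and ?p = "\<lambda>s. wderiv 1 (X s)"
  let ?w = "wderiv 1 ?V"
  have t': "0 \<le> t" using t by simp
  note Xt = solution_L2[OF t'] and V = wderiv_H1[OF time_deriv_H1[OF t]]
  note ev = eventually_shift_nonneg[OF t]
  have "((\<lambda>r. L2_norm 1 (\<lambda>\<rho>. ?p r \<rho> - ?p t \<rho>)) \<longlongrightarrow> 0) (at t)"
    using solution_continuous(2)[OF t'] at_within_interior[of t "{0..}"] t by simp
  then have p: "((\<lambda>h. L2_norm 1 (\<lambda>\<rho>. ?p (t + h) \<rho> - ?p t \<rho>)) \<longlongrightarrow> 0) (at 0)"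
    by (rule LIM_offset_zero)
  have L2: "\<forall>\<^sub>F h in at 0. (\<lambda>\<rho>. (X (t + h) \<rho> - X t \<rho>) /\<^sub>R h) \<in> L2 1"
    "\<forall>\<^sub>F h in at 0. (\<lambda>\<rho>. (?p (t + h) \<rho> - ?p t \<rho>) /\<^sub>R h) \<in> L2 1" "\<forall>\<^sub>F h in at 0. ?p (t + h) \<in> L2 1"
    using ev by (auto elim!: eventually_mono intro!: L2_scaleR L2_diff solution_L2 Xt)
  \<comment> \<open>A discrete product rule: one factor is evaluated at \<open>t + h\<close>, so
    continuity of the derivative in time is used besides the two difference quotients.\<close>
  have "((\<lambda>h. (LINT \<rho>|torus 1. ((X (t + h) \<rho> - X t \<rho>) /\<^sub>R h) $ 2 \<bullet> ?p (t + h) \<rho> $ 1)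
        + (LINT \<rho>|torus 1. X t \<rho> $ 2 \<bullet> ((?p (t + h) \<rho> - ?p t \<rho>) /\<^sub>R h) $ 1)) \<longlongrightarrow>
      (LINT \<rho>|torus 1. ?V \<rho> $ 2 \<bullet> ?p t \<rho> $ 1) + (LINT \<rho>|torus 1. X t \<rho> $ 2 \<bullet> ?w \<rho> $ 1)) (at 0)"
  proof (intro tendsto_add tendsto_L2_inner)
    show "((\<lambda>h. L2_norm 1 (\<lambda>\<rho>. ((X (t + h) \<rho> - X t \<rho>) /\<^sub>R h) $ 2 - ?V \<rho> $ 2)) \<longlongrightarrow> 0) (at 0)"
      by (rule tendsto_L2_norm_nth[OF L2(1) V(1) solution_diff_quotient(1)[OF t]])
    show "((\<lambda>h. L2_norm 1 (\<lambda>\<rho>. ?p (t + h) \<rho> $ 1 - ?p t \<rho> $ 1)) \<longlongrightarrow> 0) (at 0)"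
      by (rule tendsto_L2_norm_nth[OF L2(3) Xt(2) p])
    show "((\<lambda>h. L2_norm 1 (\<lambda>\<rho>. ((?p (t + h) \<rho> - ?p t \<rho>) /\<^sub>R h) $ 1 - ?w \<rho> $ 1)) \<longlongrightarrow> 0) (at 0)"
      by (rule tendsto_L2_norm_nth[OF L2(2) V(2) solution_diff_quotient(2)[OF t]])
  \<comment> \<open>The factor \<open>X t\<close> of the second pairing is constant in
    \<open>h\<close>; its distance to the limit is the seminorm of the zero function.\<close>
  qed (rule eventually_mono[OF L2(1) L2_nth] eventually_mono[OF L2(2) L2_nth]
        eventually_mono[OF L2(3) L2_nth] L2_nth Xt V(1,2) always_eventually allI
      | assumption | (simp add: L2_norm_const; fail))+
  moreover have "\<forall>\<^sub>F h in at 0. (LINT \<rho>|torus 1. ((X (t + h) \<rho> - X t \<rho>) /\<^sub>R h) $ 2 \<bullet> ?p (t + h) \<rho> $ 1)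
        + (LINT \<rho>|torus 1. X t \<rho> $ 2 \<bullet> ((?p (t + h) \<rho> - ?p t \<rho>) /\<^sub>R h) $ 1)
      = (area (X (t + h)) - area (X t)) / h"
    using ev
  proof eventually_elim
    case (elim h)
    note Xh = solution_L2[OF elim]
    note int = L2_integrable_inner[OF L2_nth L2_nth]
    have "(LINT \<rho>|torus 1. ((X (t + h) \<rho> - X t \<rho>) /\<^sub>R h) $ 2 \<bullet> ?p (t + h) \<rho> $ 1)
        + (LINT \<rho>|torus 1. X t \<rho> $ 2 \<bullet> ((?p (t + h) \<rho> - ?p t \<rho>) /\<^sub>R h) $ 1)
      = (LINT \<rho>|torus 1. ((X (t + h) \<rho> - X t \<rho>) /\<^sub>R h) $ 2 \<bullet> ?p (t + h) \<rho> $ 1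
          + X t \<rho> $ 2 \<bullet> ((?p (t + h) \<rho> - ?p t \<rho>) /\<^sub>R h) $ 1)"
      by (intro Bochner_Integration.integral_add[symmetric] int L2_scaleR L2_diff Xt Xh)
    also have "\<dots> = (LINT \<rho>|torus 1. (X (t + h) \<rho> $ 2 * ?p (t + h) \<rho> $ 1 - X t \<rho> $ 2 * ?p t \<rho> $ 1) / h)"
      by (intro Bochner_Integration.integral_cong refl)
         (simp add: divide_inverse algebra_simps)
    also have "\<dots> = ((LINT \<rho>|torus 1. X (t + h) \<rho> $ 2 * ?p (t + h) \<rho> $ 1)
        - (LINT \<rho>|torus 1. X t \<rho> $ 2 * ?p t \<rho> $ 1)) / h"
      using int[OF Xt(1) Xt(2), of 2 1] int[OF Xh(1) Xh(2), of 2 1] by simp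
    finally show ?case
      using elim t' by (simp add: area_eq[OF solution_closed_curve])
  qed
  ultimately have "((\<lambda>h. (area (X (t + h)) - area (X t)) / h) \<longlongrightarrow>
      (LINT \<rho>|torus 1. ?V \<rho> $ 2 \<bullet> ?p t \<rho> $ 1) + (LINT \<rho>|torus 1. X t \<rho> $ 2 \<bullet> ?w \<rho> $ 1)) (at 0)"
    by (rule Lim_transform_eventually)
  moreover have "(LINT \<rho>|torus 1. ?V \<rho> $ 2 \<bullet> ?p t \<rho> $ 1) + (LINT \<rho>|torus 1. X t \<rho> $ 2 \<bullet> ?w \<rho> $ 1) = 0"
  proof -
    have "(LINT \<rho>|torus 1. X t \<rho> $ 2 * ?w \<rho> $ 1) = - (LINT \<rho>|torus 1. ?p t \<rho> $ 2 * ?V \<rho> $ 1)"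
      by (intro weak_integration_by_parts L2_nth is_weak_deriv_nth V Xt wderiv_H1 solution_H1 t')
    then have "(LINT \<rho>|torus 1. ?V \<rho> $ 2 \<bullet> ?p t \<rho> $ 1) + (LINT \<rho>|torus 1. X t \<rho> $ 2 \<bullet> ?w \<rho> $ 1)
        = (LINT \<rho>|torus 1. ?V \<rho> $ 2 * ?p t \<rho> $ 1 - ?p t \<rho> $ 2 * ?V \<rho> $ 1)"
      using L2_integrable_inner[OF L2_nth[OF V(1)] L2_nth[OF Xt(2)], of 2 1]
        L2_integrable_inner[OF L2_nth[OF Xt(2)] L2_nth[OF V(1)], of 2 1] by simp
    \<comment> \<open>The normal times the speed is (-p2, p1) for p the derivative of the curve, so
      the integrands agree pointwise; both are 0 where p vanishes.\<close>
    also have "\<dots> = curve_inner (X t) (\<lambda>\<rho>. normal (X t) \<rho> \<bullet> ?V \<rho>) (\<lambda>_. 1)"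
      unfolding curve_inner_def curve_integral_def
    proof (intro Bochner_Integration.integral_cong refl)
      fix \<rho>
      show "?V \<rho> $ 2 * ?p t \<rho> $ 1 - ?p t \<rho> $ 2 * ?V \<rho> $ 1
          = (normal (X t) \<rho> \<bullet> ?V \<rho>) \<bullet> 1 * ds_drho (X t) \<rho>"
        by (cases "?p t \<rho> = 0")
           (simp_all add: normal_eq ds_drho_def inner_vec_def sum_2 field_simps)
    qed
    also have "\<dots> = - curve_inner (X t) (arc_deriv (X t) (\<mu> t)) (arc_deriv (X t) (\<lambda>_. 1))"
      by (intro solution_eq1 t H1_const) simp
    also have "curve_inner (X t) (arc_deriv (X t) (\<mu> t)) (arc_deriv (X t) (\<lambda>_. 1)) = 0"
      unfolding curve_inner_def curve_integral_def
    proof (rule integral_eq_zero_AE)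
      show "AE \<rho> in torus 1. arc_deriv (X t) (\<mu> t) \<rho> \<bullet> arc_deriv (X t) (\<lambda>_. 1) \<rho> * ds_drho (X t) \<rho> = 0"
        using wderiv_const[of "1::real"] by eventually_elim (simp add: arc_deriv_def)
    qed
    finally show ?thesis by simp
  qed
  ultimately show ?thesis by (simp add: DERIV_def)
qed

lemma area_constant: "0 \<le> t \<Longrightarrow> area (X t) = area (X 0)"
proof (cases "t = 0")
  case False
  assume "0 \<le> t"
  show ?thesis
  proof (rule DERIV_isconst2[of 0 t])
    show "continuous_on {0..t} (\<lambda>t. area (X t))"
      by (rule continuous_on_subset[OF continuous_on_area]) auto
  qed (use False \<open>0 \<le> t\<close> area_has_derivative_0 in auto)
qed simp

context
  assumes \<gamma>: "surface_energy \<gamma>"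
begin

lemma continuous_on_energy: "continuous_on {0..} (\<lambda>t. energy \<gamma> (X t))"
  unfolding continuous_on_def
proof
  fix t :: real assume "t \<in> {0..}"
  then have t: "0 \<le> t" by simp
  obtain C where C: "0 \<le> C"
    "\<And>p q. \<bar>hom_ext \<gamma> (- perp p) - hom_ext \<gamma> (- perp q)\<bar> \<le> C * norm (p - q)"
    using energy_density_Lipschitz[OF \<gamma>] by blast
  let ?d = "\<lambda>r. C * L2_norm 1 (\<lambda>\<rho>. wderiv 1 (X r) \<rho> - wderiv 1 (X t) \<rho>)"
  have "((\<lambda>r. energy \<gamma> (X r) - energy \<gamma> (X t)) \<longlongrightarrow> 0) (at t within {0..})"
  proof (rule Lim_null_comparison)
    have "norm (energy \<gamma> (X r) - energy \<gamma> (X t)) \<le> ?d r" if "0 \<le> r" for r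
      unfolding energy_eq real_norm_def
      by (rule integral_functional_Lipschitz(2)[OF C(2,1) solution_L2(2)[OF that] solution_L2(2)[OF t]])
    then show "\<forall>\<^sub>F r in at t within {0..}. norm (energy \<gamma> (X r) - energy \<gamma> (X t)) \<le> ?d r"
      by (simp add: eventually_at_filter)
    show "(?d \<longlongrightarrow> 0) (at t within {0..})"
      by (rule tendsto_mult_right_zero[OF solution_continuous(2)[OF t]])
  qed
  then show "((\<lambda>r. energy \<gamma> (X r)) \<longlongrightarrow> energy \<gamma> (X t)) (at t within {0..})"
    by (rule Lim_null[THEN iffD2])
qed

lemma energy_has_derivative_nonpos:
  assumes t: "0 < t"
  obtains d where "((\<lambda>t. energy \<gamma> (X t)) has_real_derivative d) (at t)" "d \<le> 0"
proof -
  let ?V = "time_deriv X t" and ?p = "\<lambda>s. wderiv 1 (X s)"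
  have t': "0 \<le> t" using t by simp
  note Xt = solution_L2[OF t'] and V = time_deriv_H1[OF t]
  obtain C where C: "0 \<le> C"
    "\<And>p q. \<bar>hom_ext \<gamma> (- perp p) - hom_ext \<gamma> (- perp q)\<bar> \<le> C * norm (p - q)"
    using energy_density_Lipschitz[OF \<gamma>] by blast
  define d where "d = curve_inner (X t)
      (\<lambda>\<rho>. Z_mat \<gamma> k (normal (X t) \<rho>) *v arc_deriv (X t) (X t) \<rho>) (arc_deriv (X t) ?V)"
  have "((\<lambda>h. ((LINT \<rho>|torus 1. hom_ext \<gamma> (- perp (?p (t + h) \<rho>)))
      - (LINT \<rho>|torus 1. hom_ext \<gamma> (- perp (?p t \<rho>)))) / h) \<longlongrightarrow> d) (at 0)"
    unfolding d_def curve_inner_Z_mat[OF \<gamma>]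
  \<comment> \<open>After unfolding, \<open>d\<close> is exactly the limit integral of this rule,
    including its default value 0.\<close>
  proof (rule integral_functional_derivative[where \<Phi>' = "\<lambda>q w. (- perp w) \<bullet> xi \<gamma> ((- perp q) /\<^sub>R norm q)",
      OF C(2,1)])
    show "\<forall>\<^sub>F h in at 0. ?p (t + h) \<in> L2 1"
      using eventually_shift_nonneg[OF t] by eventually_elim (rule solution_L2)
    show "AE \<rho> in torus 1. ?p t \<rho> \<noteq> 0" by (rule solution_nondegenerate[OF t'])
    show "(\<lambda>\<rho>. if ?p t \<rho> = 0 then 0
        else (- perp (wderiv 1 ?V \<rho>)) \<bullet> xi \<gamma> ((- perp (?p t \<rho>)) /\<^sub>R norm (?p t \<rho>)))
      \<in> borel_measurable (torus 1)"
      by (intro borel_measurable_energy_density_deriv \<gamma> L2_D(1) Xt wderiv_H1(2) V)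
  qed (intro energy_density_has_derivative[OF \<gamma>] Xt wderiv_H1(2) V solution_diff_quotient(2) t; assumption)+
  then have "((\<lambda>t. energy \<gamma> (X t)) has_real_derivative d) (at t)"
    by (simp add: DERIV_def energy_eq)
  moreover have "d \<le> 0"
  proof -
    have "d = curve_inner (X t) (\<mu> t) (\<lambda>\<rho>. normal (X t) \<rho> \<bullet> ?V \<rho>)"
      unfolding d_def by (rule solution_eq2[OF t V])
    also have "\<dots> = curve_inner (X t) (\<lambda>\<rho>. normal (X t) \<rho> \<bullet> ?V \<rho>) (\<mu> t)"
      by (simp add: curve_inner_def mult.commute)
    also have "\<dots> = - curve_inner (X t) (arc_deriv (X t) (\<mu> t)) (arc_deriv (X t) (\<mu> t))"
      using sol t by (intro solution_eq1) (auto simp: variational_solution_def)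
    also have "\<dots> \<le> 0"
      by (simp add: curve_inner_def curve_integral_def ds_drho_def)
    finally show ?thesis .
  qed
  ultimately show ?thesis by (rule that)
qed

lemma energy_antimono:
  assumes "0 \<le> s" "s \<le> t"
  shows "energy \<gamma> (X t) \<le> energy \<gamma> (X s)"
proof (rule DERIV_nonpos_imp_decreasing_open[OF assms(2)])
  show "continuous_on {s..t} (\<lambda>t. energy \<gamma> (X t))"
    using assms(1) by (intro continuous_on_subset[OF continuous_on_energy]) auto
  fix r assume "s < r" "r < t"
  then have "0 < r" using assms(1) by simp
  then show "\<exists>y. ((\<lambda>t. energy \<gamma> (X t)) has_real_derivative y) (at r) \<and> y \<le> 0"
    by (rule energy_has_derivative_nonpos) blast
qed

end

end

section \<open>The initial curve\<close>

text \<open>The comparison takes place on the unit circle, where weak derivatives are known to be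
  unique, and for the first component, whose own weak derivative appears in the claim. The factor
  \<open>L\<close> from rescaling is the Jacobian of the change of period.\<close>

lemma area_arclength_param:
  assumes "arclength_param L X0" "closed_curve Y" and eq: "AE \<rho> in torus 1. Y \<rho> = X0 (L * \<rho>)"
  shows "area Y = (LINT s|torus L. X0 s $ 2 * wderiv L (\<lambda>s. X0 s $ 1) s)"
proof -
  have L: "0 < L" and X0: "X0 \<in> H1 L" using assms(1) by (auto simp: arclength_param_def)
  have Y: "Y \<in> H1 1" using assms(2) by (simp add: closed_curve_def)
  let ?v = "wderiv L (\<lambda>s. X0 s $ 1)"
  note v = wderiv_H1(2)[OF H1_nth[OF X0, of 1]]
  note YL2 = wderiv_H1(1)[OF Y] and X0L2 = wderiv_H1(1)[OF X0]
  note m [measurable] = L2_D(1)[OF L2_nth[OF YL2, of 2]] L2_D(1)[OF L2_nth[OF wderiv_H1(2)[OF Y], of 1]]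
    L2_D(1)[OF L2_nth[OF X0L2, of 2]] L2_D(1)[OF v]
    L2_D(1)[OF L2_torus_scale[OF L L2_nth[OF X0L2, of 2]]] L2_D(1)[OF L2_torus_scale[OF L v]]
  have "AE \<rho> in torus 1. Y \<rho> $ 1 = X0 (L * \<rho>) $ 1" using eq by eventually_elim simp
  then have d: "AE \<rho> in torus 1. wderiv 1 (\<lambda>q. Y q $ 1) \<rho> = L *\<^sub>R ?v (L * \<rho>)"
    by (rule wderiv_torus_scale[OF L H1_nth[OF X0] L2_nth[OF YL2]])
  have "area Y = (LINT \<rho>|torus 1. Y \<rho> $ 2 * wderiv 1 Y \<rho> $ 1)"
    by (rule area_eq[OF assms(2)])
  also have "\<dots> = (LINT \<rho>|torus 1. L * (X0 (L * \<rho>) $ 2 * ?v (L * \<rho>)))"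
  proof (rule integral_cong_AE)
    show "AE \<rho> in torus 1. Y \<rho> $ 2 * wderiv 1 Y \<rho> $ 1 = L * (X0 (L * \<rho>) $ 2 * ?v (L * \<rho>))"
      using eq d wderiv_nth[OF Y, of 1] by eventually_elim simp
  qed measurable
  also have "\<dots> = L *\<^sub>R (LINT \<rho>|torus 1. X0 (L * \<rho>) $ 2 * ?v (L * \<rho>))" by simp
  also have "\<dots> = (LINT s|torus L. X0 s $ 2 * ?v s)"
    by (rule torus_scale(3)[OF L, symmetric]) measurable
  finally show ?thesis .
qed

lemma energy_arclength_param:
  assumes \<gamma>: "surface_energy \<gamma>" and "arclength_param L X0" and Y: "Y \<in> H1 1"
    and eq: "AE \<rho> in torus 1. Y \<rho> = X0 (L * \<rho>)"
  shows "energy \<gamma> Y = (LINT s|torus L. \<gamma> (- perp (wderiv L X0 s)))"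
proof -
  have L: "0 < L" and X0: "X0 \<in> H1 L" and unit: "AE s in torus L. norm (wderiv L X0 s) = 1"
    using assms(2) by (auto simp: arclength_param_def)
  obtain C where C: "0 \<le> C"
    "\<And>p q. \<bar>hom_ext \<gamma> (- perp p) - hom_ext \<gamma> (- perp q)\<bar> \<le> C * norm (p - q)"
    using energy_density_Lipschitz[OF \<gamma>] by blast
  let ?\<Phi> = "\<lambda>p. hom_ext \<gamma> (- perp p)" and ?v = "wderiv L X0"
  note v = wderiv_H1(2)[OF X0]
  have "C-lipschitz_on UNIV ?\<Phi>"
    using C by (intro lipschitz_onI) (auto simp: dist_norm)
  then have [measurable]: "?\<Phi> \<in> borel_measurable borel"
    by (intro borel_measurable_continuous_onI lipschitz_on_continuous_on)
  note m [measurable] = L2_D(1)[OF wderiv_H1(2)[OF Y]] L2_D(1)[OF v] L2_D(1)[OF L2_torus_scale[OF L v]]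
  have \<Phi>v: "(\<lambda>s. ?\<Phi> (?v s)) \<in> borel_measurable (torus L)"
    by (rule measurable_compose[OF m(2)]) measurable
  have "energy \<gamma> Y = (LINT \<rho>|torus 1. ?\<Phi> (wderiv 1 Y \<rho>))" by (rule energy_eq)
  also have "\<dots> = (LINT \<rho>|torus 1. L * ?\<Phi> (?v (L * \<rho>)))"
  proof (rule integral_cong_AE)
    show "(\<lambda>\<rho>. ?\<Phi> (wderiv 1 Y \<rho>)) \<in> borel_measurable (torus 1)"
      by (rule measurable_compose[OF m(1)]) measurable
    have "(\<lambda>\<rho>. ?\<Phi> (?v (L * \<rho>))) \<in> borel_measurable (torus 1)"
      by (rule measurable_compose[OF m(3)]) measurable
    then show "(\<lambda>\<rho>. L * ?\<Phi> (?v (L * \<rho>))) \<in> borel_measurable (torus 1)" by measurable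
    show "AE \<rho> in torus 1. ?\<Phi> (wderiv 1 Y \<rho>) = L * ?\<Phi> (?v (L * \<rho>))"
      using wderiv_torus_scale[OF L X0 wderiv_H1(1)[OF Y] eq]
    proof eventually_elim
      case (elim \<rho>)
      show ?case
        \<comment> \<open>Homogeneity pulls the factor \<open>L\<close> out of the density, where it
          becomes the Jacobian.\<close>
        using hom_ext_scaleR[OF L, of \<gamma> "- perp (?v (L * \<rho>))"] by (simp add: elim perp_scaleR)
    qed
  qed
  also have "\<dots> = L *\<^sub>R (LINT \<rho>|torus 1. ?\<Phi> (?v (L * \<rho>)))" by simp
  also have "\<dots> = (LINT s|torus L. ?\<Phi> (?v s))"
    by (rule torus_scale(3)[OF L \<Phi>v, symmetric])
  also have "\<dots> = (LINT s|torus L. \<gamma> (- perp (?v s)))"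
  proof (rule integral_cong_AE[OF \<Phi>v])
    show AE: "AE s in torus L. ?\<Phi> (?v s) = \<gamma> (- perp (?v s))"
      using unit by eventually_elim (simp add: hom_ext_sphere)
    \<comment> \<open>\<gamma> is arbitrary off the unit circle, so measurability is inherited from
      \<open>hom_ext \<gamma>\<close>, with which it agrees almost everywhere.\<close>
    show "(\<lambda>s. \<gamma> (- perp (?v s))) \<in> borel_measurable (torus L)"
      by (rule borel_measurable_torus_AE[OF \<Phi>v AE])
  qed
  finally show ?thesis .
qed

theorem proposition2p2:
  fixes \<gamma> k :: "real^2 \<Rightarrow> real"
    and X :: "real \<Rightarrow> real \<Rightarrow> real^2" and \<mu> :: "real \<Rightarrow> real \<Rightarrow> real"
    and L0 :: real and X0 :: "real \<Rightarrow> real^2"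
  assumes "surface_energy \<gamma>"
    and "\<forall>n\<in>sphere 0 1. 0 < k n"
    and "variational_solution \<gamma> k X \<mu>"
    and "arclength_param L0 X0"
    and "AE \<rho> in torus 1. X 0 \<rho> = X0 (L0 * \<rho>)"
  shows "(\<forall>t\<ge>0. area (X t) = (LINT s|torus L0. X0 s $ 2 * wderiv L0 (\<lambda>s. X0 s $ 1) s)) \<and>
         (\<forall>t1\<ge>0. \<forall>t\<ge>t1.
            energy \<gamma> (X t) \<le> energy \<gamma> (X t1) \<and>
            energy \<gamma> (X t1) \<le> (LINT s|torus L0. \<gamma> (- perp (wderiv L0 X0 s))))"
proof -
  note sol = assms(3)
  have area: "area (X 0) = (LINT s|torus L0. X0 s $ 2 * wderiv L0 (\<lambda>s. X0 s $ 1) s)"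
    using assms(4) solution_closed_curve[OF sol order_refl] assms(5) by (rule area_arclength_param)
  have energy: "energy \<gamma> (X 0) = (LINT s|torus L0. \<gamma> (- perp (wderiv L0 X0 s)))"
    using assms(1,4) solution_H1[OF sol order_refl] assms(5) by (rule energy_arclength_param)
  note antimono = energy_antimono[OF sol assms(1)]
  show ?thesis
    \<comment> \<open>Both right-hand sides become values at time 0, so the second energy bound is
      monotonicity between 0 and \<open>t1\<close>.\<close>
    unfolding area[symmetric] energy[symmetric]
    by (intro conjI allI impI antimono area_constant[OF sol] order_refl)
qed

end
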